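(* Let $(A,L_A)$ and $(B,L_B)$ be compact quantum metric spaces. If $\operatorname{dist}_q(A,B)=0$, then there is an isometry between $(A,L_A)$ and $(B,L_B)$.
   Context: An order-unit space is a real partially ordered vector space $A$ with a distinguished element $e=e_A$ (the order unit) such that (1) for each $a\in A$ there is $r\in\mathbb{R}$ with $a\le re$; (2) if $a\in A$ and $a\le re$ for all real $r>0$, then $a\le 0$. Its norm is $\|a\|=\inf\{r: -re\le a\le re\}$. A state is an element $\mu$ of the Banach-space dual $A'$ with $\mu(e)=1=\|\mu\|'$; $S(A)$ denotes the set of states, with the $w^*$-topology. For a seminorm $L$ on $A$ put $\rho_L(\mu,\nu)=\sup\{|\mu(a)-\nu(a)|: L(a)\le 1\}$ for $\mu,\nu\in S(A)$. A Lip-norm on $A$ is a seminorm $L$ such that $L(a)=0$ iff $a\in\mathbb{R}e$, and the topology on $S(A)$ from $\rho_L$ is the $w^*$-topology. A compact quantum metric space is a pair $(A,L)$ with $A$ an order-unit space and $L$ a Lip-norm on $A$. For compact quantum metric spaces $(A,L_A)$, $(B,L_B)$, the direct sum $A\oplus B$ is an order-unit space with order unit $(e_A,e_B)$ and componentwise order; via the coordinate projections, $S(A)$ and $S(B)$ are viewed as subsets of $S(A\oplus B)$. $\mathcal{M}(L_A,L_B)$ is the set of Lip-norms $L$ on $A\oplus B$ which induce $L_A$ and $L_B$, i.e. $L_A(a)=\inf_{b\in B}L(a,b)$ and $L_B(b)=\inf_{a\in A}L(a,b)$. The quantum Gromov–Hausdorff distance is $\operatorname{dist}_q(A,B)=\inf\{\operatorname{dist}_H^{\rho_L}(S(A),S(B)):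 L\in\mathcal{M}(L_A,L_B)\}$, where $\operatorname{dist}_H^{\rho_L}$ is Hausdorff distance for $\rho_L$. Closure: for a compact quantum metric space $(A,L)$ let $\bar A$ be the norm completion of $A$ (again an order-unit space) and let $E$ be the closure in $\bar A$ of $\{a\in A: L(a)\le 1\}$. The closure $(A^c,L^c)$ of $(A,L)$ is given by $A^c=\bigcup_{t>0}tE\subseteq\bar A$ with $L^c(a)=\inf\{t>0: a\in tE\}$, so that $\{L^c\le 1\}=E$; it is a compact quantum metric space. An isometry from $(A,L_A)$ to $(B,L_B)$ is an isomorphism of order-unit spaces $\varphi:A^c\to B^c$ (a linear bijection that preserves the order in both directions and the order unit) such that $L_A^c=L_B^c\circ\varphi$. *)

theory Defs
  imports "HOL-Analysis.Analysis"
begin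

text \<open>
  Positivity of the order unit is part of what is meant by an order unit: without it, for
  instance, the reals with distinguished element \<open>-1\<close> would satisfy the other two axioms,
  and the norm formula below would be meaningless.  The zero space is not excluded; it has
  no states.
\<close>

class order_unit_space = ordered_real_vector +
  fixes order_unit :: 'a
  assumes order_unit_nonneg: "0 \<le> order_unit"
    and order_unit_bound: "\<exists>r::real. a \<le> r *\<^sub>R order_unit"
    and order_unit_archimedean: "(\<And>r::real. 0 < r \<Longrightarrow> a \<le> r *\<^sub>R order_unit) \<Longrightarrow> a \<le> 0"

text \<open>
  The restriction to \<open>0 \<le> r\<close> matters only for the zero space, where the unrestricted set of
  radii is all of the reals; otherwise \<open>- r e \<le> r e\<close> already forces \<open>0 \<le> r\<close>.
\<close>

definition ou_norm :: "'a::order_unit_space \<Rightarrow> real" where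
  "ou_norm a = Inf {r. 0 \<le> r \<and> - (r *\<^sub>R order_unit) \<le> a \<and> a \<le> r *\<^sub>R order_unit}"

lemma ou_scale_mono:
  "r \<le> s \<Longrightarrow> r *\<^sub>R order_unit \<le> s *\<^sub>R (order_unit :: 'a::order_unit_space)"
  by (rule scaleR_right_mono[OF _ order_unit_nonneg])

lemma ou_upper_attained:
  fixes a :: "'a::order_unit_space"
  obtains d where "0 \<le> d" "a \<le> d *\<^sub>R order_unit"
    "\<And>r. 0 \<le> r \<Longrightarrow> a \<le> r *\<^sub>R order_unit \<Longrightarrow> d \<le> r"
proof -
  define S where "S = {r. 0 \<le> r \<and> a \<le> r *\<^sub>R (order_unit::'a)}"
  have bdd: "bdd_below S" by (rule bdd_belowI[of _ 0]) (auto simp: S_def)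
  obtain r where r: "a \<le> r *\<^sub>R order_unit" using order_unit_bound by blast
  have "max r 0 \<in> S"
    using order_trans[OF r ou_scale_mono[of r "max r 0"]] by (simp add: S_def)
  then have ne: "S \<noteq> {}" by blast
  have up: "a \<le> Inf S *\<^sub>R order_unit"
  proof -
    have "a - Inf S *\<^sub>R order_unit \<le> t *\<^sub>R order_unit" if t: "0 < t" for t :: real
    proof -
      obtain s where s: "s \<in> S" "s < Inf S + t"
        using cInf_lessD[OF ne, of "Inf S + t"] t by auto
      have "a \<le> (Inf S + t) *\<^sub>R order_unit"
        using s(1) order_trans[OF _ ou_scale_mono[OF less_imp_le[OF s(2)]]] by (auto simp: S_def)
      then show ?thesis by (simp add: algebra_simps)
    qed
    then have "a - Inf S *\<^sub>R order_unit \<le> 0" by (rule order_unit_archimedean)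
    then show ?thesis by simp
  qed
  show thesis
  proof (rule that[OF _ up])
    show "0 \<le> Inf S" by (rule cInf_greatest[OF ne]) (simp add: S_def)
    show "Inf S \<le> r" if "0 \<le> r" "a \<le> r *\<^sub>R order_unit" for r
      by (rule cInf_lower[OF _ bdd]) (simp add: S_def that)
  qed
qed

lemma ou_norm_props:
  fixes a :: "'a::order_unit_space"
  shows "0 \<le> ou_norm a" "a \<le> ou_norm a *\<^sub>R order_unit" "- (ou_norm a *\<^sub>R order_unit) \<le> a"
    "\<And>r. 0 \<le> r \<Longrightarrow> - (r *\<^sub>R order_unit) \<le> a \<Longrightarrow> a \<le> r *\<^sub>R order_unit \<Longrightarrow> ou_norm a \<le> r"
proof -
  obtain d where d: "0 \<le> d" "a \<le> d *\<^sub>R order_unit"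
    "\<And>r. 0 \<le> r \<Longrightarrow> a \<le> r *\<^sub>R order_unit \<Longrightarrow> d \<le> r"
    using ou_upper_attained[of a] by blast
  obtain d' where d': "0 \<le> d'" "- a \<le> d' *\<^sub>R order_unit"
    "\<And>r. 0 \<le> r \<Longrightarrow> - a \<le> r *\<^sub>R order_unit \<Longrightarrow> d' \<le> r"
    using ou_upper_attained[of "- a"] by blast
  have m: "a \<le> max d d' *\<^sub>R order_unit" "- a \<le> max d d' *\<^sub>R order_unit"
    using order_trans[OF d(2) ou_scale_mono[of d "max d d'"]]
      order_trans[OF d'(2) ou_scale_mono[of d' "max d d'"]] by simp_all
  have eq: "ou_norm a = max d d'"
    unfolding ou_norm_def
  proof (rule cInf_eq_minimum)
    show "max d d' \<in> {r. 0 \<le> r \<and> - (r *\<^sub>R order_unit) \<le> a \<and> a \<le> r *\<^sub>R order_unit}"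
      using m d(1) by (simp add: minus_le_iff max_def)
    show "max d d' \<le> r"
      if "r \<in> {r. 0 \<le> r \<and> - (r *\<^sub>R order_unit) \<le> a \<and> a \<le> r *\<^sub>R order_unit}" for r
      using that d(3) d'(3) by (auto simp: minus_le_iff)
  qed
  show "0 \<le> ou_norm a" "a \<le> ou_norm a *\<^sub>R order_unit" "- (ou_norm a *\<^sub>R order_unit) \<le> a"
    using m d(1) by (simp_all only: eq) (auto simp: minus_le_iff max_def)
  show "ou_norm a \<le> r" if "0 \<le> r" "- (r *\<^sub>R order_unit) \<le> a" "a \<le> r *\<^sub>R order_unit" for r
    using that d(3)[of r] d'(3)[of r] by (simp add: eq minus_le_iff)
qed

lemma ou_norm_triangle: "ou_norm (a + b) \<le> ou_norm a + ou_norm (b :: 'a::order_unit_space)"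
  using add_mono[OF ou_norm_props(2)[of a] ou_norm_props(2)[of b]]
    add_mono[OF ou_norm_props(3)[of a] ou_norm_props(3)[of b]]
    ou_norm_props(1)[of a] ou_norm_props(1)[of b]
  by (intro ou_norm_props(4)) (auto simp: scaleR_add_left algebra_simps)

lemma ou_norm_minus [simp]: "ou_norm (- a) = ou_norm (a :: 'a::order_unit_space)"
  unfolding ou_norm_def by (simp add: minus_le_iff conj_commute)

lemma ou_norm_zero [simp]: "ou_norm (0 :: 'a::order_unit_space) = 0"
  by (intro antisym ou_norm_props) auto

lemma ou_norm_eq_0_iff [simp]: "ou_norm a = 0 \<longleftrightarrow> a = (0 :: 'a::order_unit_space)"
  using ou_norm_props(2,3)[of a] by (auto intro: antisym)

lemma ou_norm_diff_commute: "ou_norm (a - b) = ou_norm (b - a :: 'a::order_unit_space)"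
  using ou_norm_minus[of "a - b"] by simp

lemma ou_norm_diff_triangle:
  "ou_norm (a - c) \<le> ou_norm (a - b) + ou_norm (b - c :: 'a::order_unit_space)"
  using ou_norm_triangle[of "a - b" "b - c"] by simp

lemma ou_norm_scaleR_le: "ou_norm (r *\<^sub>R a) \<le> \<bar>r\<bar> * ou_norm (a :: 'a::order_unit_space)"
proof (cases "0 \<le> r")
  case True
  then show ?thesis
    using scaleR_left_mono[OF ou_norm_props(2)[of a] True]
      scaleR_left_mono[OF ou_norm_props(3)[of a] True]
    by (intro ou_norm_props(4)) (auto simp: ou_norm_props(1))
next
  case False
  then have r: "0 \<le> - r" by simp
  have "ou_norm ((- r) *\<^sub>R a) \<le> - r * ou_norm a"
    using scaleR_left_mono[OF ou_norm_props(2)[of a] r]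
      scaleR_left_mono[OF ou_norm_props(3)[of a] r] False
    by (intro ou_norm_props(4)) (auto simp: ou_norm_props(1) mult_nonpos_nonneg)
  then show ?thesis using False by simp
qed

lemma ou_norm_mono: "0 \<le> a \<Longrightarrow> a \<le> b \<Longrightarrow> ou_norm a \<le> ou_norm (b :: 'a::order_unit_space)"
  using ou_scale_mono[OF ou_norm_props(1)[of b], where 'a = 'a]
    order_trans[of "- (ou_norm b *\<^sub>R order_unit)" 0 a]
    order_trans[OF _ ou_norm_props(2)[of b], of a]
  by (intro ou_norm_props(4)) (auto simp: ou_norm_props(1))


text \<open>
  The direct sum is the product type with the library's componentwise order.  Its norm is
  \<open>ou_norm\<close> (the maximum of the two norms), not the Euclidean norm of the library's
  product instance.  The chain of superclasses is needed for compatibility with the existing product instance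
  for \<open>ordered_euclidean_space\<close>.
\<close>

instance prod :: (ordered_ab_semigroup_add, ordered_ab_semigroup_add) ordered_ab_semigroup_add
  by intro_classes (auto simp: less_eq_prod_def intro: add_left_mono)

instance prod :: (ordered_cancel_ab_semigroup_add, ordered_cancel_ab_semigroup_add) ordered_cancel_ab_semigroup_add
  ..

instance prod :: (ordered_comm_monoid_add, ordered_comm_monoid_add) ordered_comm_monoid_add
  ..

instance prod :: (ordered_cancel_comm_monoid_add, ordered_cancel_comm_monoid_add) ordered_cancel_comm_monoid_add
  ..

instance prod :: (ordered_ab_semigroup_add_imp_le, ordered_ab_semigroup_add_imp_le) ordered_ab_semigroup_add_imp_le
  by intro_classes (auto simp: less_eq_prod_def)

instance prod :: (ordered_ab_semigroup_monoid_add_imp_le, ordered_ab_semigroup_monoid_add_imp_le) ordered_ab_semigroup_monoid_add_imp_le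
  ..

instance prod :: (ordered_ab_group_add, ordered_ab_group_add) ordered_ab_group_add
  ..

instance prod :: (ordered_real_vector, ordered_real_vector) ordered_real_vector
  by intro_classes (auto simp: less_eq_prod_def intro: scaleR_left_mono scaleR_right_mono)

instantiation prod :: (order_unit_space, order_unit_space) order_unit_space
begin

definition order_unit_prod :: "'a \<times> 'b" where
  "order_unit_prod = (order_unit, order_unit)"

instance
proof
  show "0 \<le> (order_unit :: 'a \<times> 'b)"
    by (simp add: order_unit_prod_def less_eq_prod_def order_unit_nonneg)
  show "\<exists>r. a \<le> r *\<^sub>R order_unit" for a :: "'a \<times> 'b"
  proof -
    obtain r s where rs: "fst a \<le> r *\<^sub>R order_unit" "snd a \<le> s *\<^sub>R order_unit"
      using order_unit_bound[of "fst a"] order_unit_bound[of "snd a"] by auto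
    have "a \<le> max r s *\<^sub>R order_unit"
      using order_trans[OF rs(1) ou_scale_mono[of r "max r s"]]
        order_trans[OF rs(2) ou_scale_mono[of s "max r s"]]
      by (simp add: order_unit_prod_def less_eq_prod_def)
    then show ?thesis ..
  qed
  show "a \<le> 0" if "\<And>r. 0 < r \<Longrightarrow> a \<le> r *\<^sub>R order_unit" for a :: "'a \<times> 'b"
    using that by (auto simp: order_unit_prod_def less_eq_prod_def intro!: order_unit_archimedean)
qed

end


definition ou_dual :: "('a::order_unit_space \<Rightarrow> real) set" where
  "ou_dual = {\<mu>. linear \<mu> \<and> (\<exists>K. \<forall>a. \<bar>\<mu> a\<bar> \<le> ou_norm a * K)}"

definition dual_norm :: "('a::order_unit_space \<Rightarrow> real) \<Rightarrow> real" where
  "dual_norm \<mu> = (SUP a\<in>{a. ou_norm a \<le> 1}. \<bar>\<mu> a\<bar>)"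

definition states :: "('a::order_unit_space \<Rightarrow> real) set" where
  "states = {\<mu> \<in> ou_dual. \<mu> order_unit = 1 \<and> dual_norm \<mu> = 1}"

text \<open>The weak-* topology is the topology of pointwise convergence, that is, the one
  inherited from the product topology on all real functions on the space.\<close>

definition weak_star_states :: "('a::order_unit_space \<Rightarrow> real) topology" where
  "weak_star_states = subtopology (powertop_real UNIV) states"

definition seminorm :: "('a::real_vector \<Rightarrow> real) \<Rightarrow> bool" where
  "seminorm L \<longleftrightarrow>
     (\<forall>a b. L (a + b) \<le> L a + L b) \<and> (\<forall>r a. L (r *\<^sub>R a) = \<bar>r\<bar> * L a)"

text \<open>For an arbitrary seminorm the supremum may be infinite.\<close>

definition rho :: "('a::order_unit_space \<Rightarrow> real) \<Rightarrow> ('a \<Rightarrow> real) \<Rightarrow> ('a \<Rightarrow> real) \<Rightarrow> ennreal" where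
  "rho L \<mu> \<nu> = (SUP a\<in>{a. L a \<le> 1}. ennreal \<bar>\<mu> a - \<nu> a\<bar>)"

definition rho_open :: "('a::order_unit_space \<Rightarrow> real) \<Rightarrow> ('a \<Rightarrow> real) set \<Rightarrow> bool" where
  "rho_open L U \<longleftrightarrow> U \<subseteq> states \<and>
     (\<forall>\<mu>\<in>U. \<exists>\<epsilon>>0. \<forall>\<nu>\<in>states. rho L \<mu> \<nu> < \<epsilon> \<longrightarrow> \<nu> \<in> U)"

definition rho_topology :: "('a::order_unit_space \<Rightarrow> real) \<Rightarrow> ('a \<Rightarrow> real) topology" where
  "rho_topology L = topology (rho_open L)"

lemma openin_rho_topology: "openin (rho_topology L) U \<longleftrightarrow> rho_open L U"
proof -
  have "istopology (rho_open L)"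
    unfolding istopology_def
  proof safe
    fix S T assume S: "rho_open L S" and T: "rho_open L T"
    show "rho_open L (S \<inter> T)"
      unfolding rho_open_def
    proof (intro conjI ballI)
      show "S \<inter> T \<subseteq> states" using S by (auto simp: rho_open_def)
      fix \<mu> assume "\<mu> \<in> S \<inter> T"
      then obtain d e where
        "0 < d" "\<forall>\<nu>\<in>states. rho L \<mu> \<nu> < d \<longrightarrow> \<nu> \<in> S"
        "0 < e" "\<forall>\<nu>\<in>states. rho L \<mu> \<nu> < e \<longrightarrow> \<nu> \<in> T"
        using S T unfolding rho_open_def by blast
      then show "\<exists>\<epsilon>>0. \<forall>\<nu>\<in>states. rho L \<mu> \<nu> < \<epsilon> \<longrightarrow> \<nu> \<in> S \<inter> T"
        by (intro exI[of _ "min d e"]) auto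
    qed
  next
    fix \<K> assume K: "\<forall>K\<in>\<K>. rho_open L K"
    show "rho_open L (\<Union>\<K>)"
      unfolding rho_open_def
    proof (intro conjI ballI)
      show "\<Union>\<K> \<subseteq> states" using K by (auto simp: rho_open_def)
      fix \<mu> assume "\<mu> \<in> \<Union>\<K>"
      then obtain S where S: "S \<in> \<K>" "\<mu> \<in> S" by blast
      then obtain e where "0 < e" "\<forall>\<nu>\<in>states. rho L \<mu> \<nu> < e \<longrightarrow> \<nu> \<in> S"
        using K unfolding rho_open_def by meson
      then show "\<exists>\<epsilon>>0. \<forall>\<nu>\<in>states. rho L \<mu> \<nu> < \<epsilon> \<longrightarrow> \<nu> \<in> \<Union>\<K>"
        using S(1) by blast
    qed
  qed
  then show ?thesis by (simp add: rho_topology_def)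
qed

text \<open>A compact quantum metric space is a type of sort \<open>order_unit_space\<close> with a Lip-norm.\<close>

definition lip_norm :: "('a::order_unit_space \<Rightarrow> real) \<Rightarrow> bool" where
  "lip_norm L \<longleftrightarrow> seminorm L \<and> (\<forall>a. L a = 0 \<longleftrightarrow> a \<in> range (\<lambda>r. r *\<^sub>R order_unit)) \<and>
     rho_topology L = weak_star_states"


definition hausdorff_dist :: "('p \<Rightarrow> 'p \<Rightarrow> ennreal) \<Rightarrow> 'p set \<Rightarrow> 'p set \<Rightarrow> ennreal" where
  "hausdorff_dist d X Y = max (SUP x\<in>X. INF y\<in>Y. d x y) (SUP y\<in>Y. INF x\<in>X. d x y)"

definition inducing_lip_norms ::
  "('a::order_unit_space \<Rightarrow> real) \<Rightarrow> ('b::order_unit_space \<Rightarrow> real) \<Rightarrow> ('a \<times> 'b \<Rightarrow> real) set" where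
  "inducing_lip_norms LA LB =
     {L. lip_norm L \<and> (\<forall>a. LA a = (INF b. L (a, b))) \<and> (\<forall>b. LB b = (INF a. L (a, b)))}"

definition dist_q ::
  "('a::order_unit_space \<Rightarrow> real) \<Rightarrow> ('b::order_unit_space \<Rightarrow> real) \<Rightarrow> ennreal" where
  "dist_q LA LB = (INF L\<in>inducing_lip_norms LA LB.
     hausdorff_dist (rho L) ((\<lambda>\<mu>. \<mu> \<circ> fst) ` states) ((\<lambda>\<nu>. \<nu> \<circ> snd) ` states))"


text \<open>The completion consists of the Cauchy sequences modulo null sequences.\<close>

definition ou_Cauchy :: "(nat \<Rightarrow> 'a::order_unit_space) \<Rightarrow> bool" where
  "ou_Cauchy X \<longleftrightarrow> (\<forall>\<epsilon>>0. \<exists>N. \<forall>m\<ge>N. \<forall>n\<ge>N. ou_norm (X m - X n) < \<epsilon>)"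

definition completion_rel :: "(nat \<Rightarrow> 'a::order_unit_space) \<Rightarrow> (nat \<Rightarrow> 'a) \<Rightarrow> bool" where
  "completion_rel X Y \<longleftrightarrow>
     ou_Cauchy X \<and> ou_Cauchy Y \<and> (\<lambda>n. ou_norm (X n - Y n)) \<longlonglongrightarrow> 0"

lemma ou_null_le:
  assumes "Y \<longlonglongrightarrow> (0::real)" "\<And>n. ou_norm (X n :: 'a::order_unit_space) \<le> Y n"
  shows "(\<lambda>n. ou_norm (X n)) \<longlonglongrightarrow> 0"
  by (rule tendsto_sandwich[OF _ _ tendsto_const assms(1)])
    (auto simp: assms(2) ou_norm_props(1))

lemma ou_null_add:
  fixes X Y :: "nat \<Rightarrow> 'a::order_unit_space"
  assumes "(\<lambda>n. ou_norm (X n)) \<longlonglongrightarrow> 0" "(\<lambda>n. ou_norm (Y n)) \<longlonglongrightarrow> 0"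
  shows "(\<lambda>n. ou_norm (X n + Y n)) \<longlonglongrightarrow> 0"
  using tendsto_add[OF assms] by (intro ou_null_le) (auto intro: ou_norm_triangle)

lemma ou_null_scaleR:
  fixes X :: "nat \<Rightarrow> 'a::order_unit_space"
  assumes "(\<lambda>n. ou_norm (X n)) \<longlonglongrightarrow> 0"
  shows "(\<lambda>n. ou_norm (r *\<^sub>R X n)) \<longlonglongrightarrow> 0"
  using tendsto_mult[OF tendsto_const[of "\<bar>r\<bar>"] assms]
  by (intro ou_null_le) (auto intro: ou_norm_scaleR_le)

lemma ou_null_minus:
  fixes X :: "nat \<Rightarrow> 'a::order_unit_space"
  assumes "(\<lambda>n. ou_norm (X n)) \<longlonglongrightarrow> 0"
  shows "(\<lambda>n. ou_norm (- X n)) \<longlonglongrightarrow> 0"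
  using assms by simp

lemma ou_Cauchy_const [simp]: "ou_Cauchy (\<lambda>n. a)"
  by (simp add: ou_Cauchy_def)

lemma ou_Cauchy_add:
  assumes "ou_Cauchy X" "ou_Cauchy Y" shows "ou_Cauchy (\<lambda>n. X n + Y n)"
  unfolding ou_Cauchy_def
proof (intro allI impI)
  fix \<epsilon> :: real assume "0 < \<epsilon>"
  then have "0 < \<epsilon> / 2" by simp
  then obtain M N where M: "\<forall>m\<ge>M. \<forall>n\<ge>M. ou_norm (X m - X n) < \<epsilon> / 2"
    and N: "\<forall>m\<ge>N. \<forall>n\<ge>N. ou_norm (Y m - Y n) < \<epsilon> / 2"
    using assms unfolding ou_Cauchy_def by blast
  have "ou_norm (X m + Y m - (X n + Y n)) < \<epsilon>" if "m \<ge> max M N" "n \<ge> max M N" for m n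
  proof -
    have "ou_norm (X m + Y m - (X n + Y n)) \<le> ou_norm (X m - X n) + ou_norm (Y m - Y n)"
      using ou_norm_triangle[of "X m - X n" "Y m - Y n"] by (simp add: algebra_simps)
    moreover have "ou_norm (X m - X n) < \<epsilon> / 2" "ou_norm (Y m - Y n) < \<epsilon> / 2"
      using M N that by auto
    ultimately show ?thesis by linarith
  qed
  then show "\<exists>N. \<forall>m\<ge>N. \<forall>n\<ge>N. ou_norm (X m + Y m - (X n + Y n)) < \<epsilon>" by blast
qed

lemma ou_Cauchy_scaleR:
  assumes "ou_Cauchy X" shows "ou_Cauchy (\<lambda>n. r *\<^sub>R X n)"
  unfolding ou_Cauchy_def
proof (intro allI impI)
  fix \<epsilon> :: real assume "0 < \<epsilon>"
  then have "0 < \<epsilon> / (\<bar>r\<bar> + 1)" by simp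
  then obtain N where N: "\<forall>m\<ge>N. \<forall>n\<ge>N. ou_norm (X m - X n) < \<epsilon> / (\<bar>r\<bar> + 1)"
    using assms unfolding ou_Cauchy_def by blast
  have "ou_norm (r *\<^sub>R X m - r *\<^sub>R X n) < \<epsilon>" if "m \<ge> N" "n \<ge> N" for m n
  proof -
    have "ou_norm (r *\<^sub>R X m - r *\<^sub>R X n) \<le> \<bar>r\<bar> * ou_norm (X m - X n)"
      using ou_norm_scaleR_le[of r "X m - X n"] by (simp add: scaleR_diff_right)
    also have "\<dots> \<le> (\<bar>r\<bar> + 1) * ou_norm (X m - X n)"
      by (intro mult_right_mono) (auto simp: ou_norm_props(1))
    also have "\<dots> < \<epsilon>" using N that by (simp add: field_simps)
    finally show ?thesis .
  qed
  then show "\<exists>N. \<forall>m\<ge>N. \<forall>n\<ge>N. ou_norm (r *\<^sub>R X m - r *\<^sub>R X n) < \<epsilon>" by blast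
qed

lemma ou_Cauchy_minus: "ou_Cauchy X \<Longrightarrow> ou_Cauchy (\<lambda>n. - X n)"
  using ou_Cauchy_scaleR[of X "-1"] by simp

lemma ou_Cauchy_bounded:
  assumes "ou_Cauchy X" obtains M where "0 \<le> M" "\<And>n. ou_norm (X n) \<le> M"
proof -
  obtain N where N: "\<forall>m\<ge>N. \<forall>n\<ge>N. ou_norm (X m - X n) < 1"
    using assms unfolding ou_Cauchy_def by (meson zero_less_one)
  define M where "M = Max ((\<lambda>n. ou_norm (X n)) ` {..N}) + 1"
  have le: "ou_norm (X n) \<le> M - 1" if "n \<le> N" for n
    using that by (auto simp: M_def)
  have "ou_norm (X n) \<le> M" for n
  proof (cases "n \<le> N")
    case False
    then have "ou_norm (X n - X N) < 1" using N by simp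
    then show ?thesis using ou_norm_triangle[of "X n - X N" "X N"] le[of N] by simp
  qed (use le[of n] in simp)
  moreover have "0 \<le> M" using ou_norm_props(1)[of "X N"] le[of N] by linarith
  ultimately show thesis using that by blast
qed

quotient_type (overloaded) 'a completion = "nat \<Rightarrow> 'a::order_unit_space" / partial: completion_rel
proof (rule part_equivpI)
  show "\<exists>X :: nat \<Rightarrow> 'a. completion_rel X X"
    by (intro exI[of _ "\<lambda>n. 0"]) (simp add: completion_rel_def)
  show "symp (completion_rel :: (nat \<Rightarrow> 'a) \<Rightarrow> _)"
    by (rule sympI) (auto simp: completion_rel_def ou_norm_diff_commute)
  show "transp (completion_rel :: (nat \<Rightarrow> 'a) \<Rightarrow> _)"
  proof (rule transpI)
    fix X Y Z :: "nat \<Rightarrow> 'a" assume "completion_rel X Y" "completion_rel Y Z"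
    then show "completion_rel X Z"
      using ou_null_add[of "\<lambda>n. X n - Y n" "\<lambda>n. Y n - Z n"] by (simp add: completion_rel_def)
  qed
qed

text \<open>The positive cone of the completion is the closure of the positive cone of the space.\<close>

instantiation completion :: (order_unit_space) order_unit_space
begin

lift_definition zero_completion :: "'a completion" is "\<lambda>n. 0"
  by (simp add: completion_rel_def)

lift_definition plus_completion :: "'a completion \<Rightarrow> 'a completion \<Rightarrow> 'a completion"
  is "\<lambda>X Y n. X n + Y n"
proof -
  fix X X' Y Y' :: "nat \<Rightarrow> 'a" assume "completion_rel X X'" "completion_rel Y Y'"
  then show "completion_rel (\<lambda>n. X n + Y n) (\<lambda>n. X' n + Y' n)"
    using ou_null_add[of "\<lambda>n. X n - X' n" "\<lambda>n. Y n - Y' n"]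
    by (simp add: completion_rel_def ou_Cauchy_add algebra_simps)
qed

lift_definition uminus_completion :: "'a completion \<Rightarrow> 'a completion" is "\<lambda>X n. - X n"
proof -
  fix X X' :: "nat \<Rightarrow> 'a" assume "completion_rel X X'"
  then show "completion_rel (\<lambda>n. - X n) (\<lambda>n. - X' n)"
    by (simp add: completion_rel_def ou_Cauchy_minus ou_norm_diff_commute)
qed

definition minus_completion :: "'a completion \<Rightarrow> 'a completion \<Rightarrow> 'a completion" where
  "minus_completion x y = x + - y"

lift_definition scaleR_completion :: "real \<Rightarrow> 'a completion \<Rightarrow> 'a completion"
  is "\<lambda>r X n. r *\<^sub>R X n"
proof -
  fix r and X X' :: "nat \<Rightarrow> 'a" assume "completion_rel X X'"
  then show "completion_rel (\<lambda>n. r *\<^sub>R X n) (\<lambda>n. r *\<^sub>R X' n)"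
    using ou_null_scaleR[of "\<lambda>n. X n - X' n" r]
    by (simp add: completion_rel_def ou_Cauchy_scaleR algebra_simps)
qed

lift_definition less_eq_completion :: "'a completion \<Rightarrow> 'a completion \<Rightarrow> bool"
  is "\<lambda>X Y. \<exists>Z. (\<forall>n. 0 \<le> Z n) \<and> (\<lambda>n. ou_norm (Y n - X n - Z n)) \<longlonglongrightarrow> 0"
proof -
  have *: "\<exists>Z. (\<forall>n. 0 \<le> Z n) \<and> (\<lambda>n. ou_norm (Y' n - X' n - Z n)) \<longlonglongrightarrow> 0"
    if X: "completion_rel X X'" and Y: "completion_rel Y Y'"
      and Z: "\<exists>Z. (\<forall>n. 0 \<le> Z n) \<and> (\<lambda>n. ou_norm (Y n - X n - Z n)) \<longlonglongrightarrow> 0"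
    for X X' Y Y' :: "nat \<Rightarrow> 'a"
  proof -
    obtain Z where Z: "\<forall>n. 0 \<le> Z n" "(\<lambda>n. ou_norm (Y n - X n - Z n)) \<longlonglongrightarrow> 0"
      using Z by blast
    have "(\<lambda>n. ou_norm ((Y n - X n - Z n) + ((X n - X' n) + - (Y n - Y' n)))) \<longlonglongrightarrow> 0"
      using X Y Z(2) by (intro ou_null_add ou_null_minus) (simp_all add: completion_rel_def)
    moreover have "(Y n - X n - Z n) + ((X n - X' n) + - (Y n - Y' n)) = Y' n - X' n - Z n" for n
      by simp
    ultimately show ?thesis using Z(1) by auto
  qed
  fix X X' Y Y' :: "nat \<Rightarrow> 'a"
  assume X: "completion_rel X X'" and Y: "completion_rel Y Y'"
  then have X': "completion_rel X' X" and Y': "completion_rel Y' Y"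
    by (auto simp: completion_rel_def ou_norm_diff_commute)
  show "(\<exists>Z. (\<forall>n. 0 \<le> Z n) \<and> (\<lambda>n. ou_norm (Y n - X n - Z n)) \<longlonglongrightarrow> 0) \<longleftrightarrow>
    (\<exists>Z. (\<forall>n. 0 \<le> Z n) \<and> (\<lambda>n. ou_norm (Y' n - X' n - Z n)) \<longlonglongrightarrow> 0)"
    using *[OF X Y] *[OF X' Y'] by blast
qed

definition less_completion :: "'a completion \<Rightarrow> 'a completion \<Rightarrow> bool" where
  "less_completion x y \<longleftrightarrow> x \<le> y \<and> \<not> y \<le> x"

lift_definition order_unit_completion :: "'a completion" is "\<lambda>n. order_unit"
  by (simp add: completion_rel_def)

instance
proof
  fix x y z :: "'a completion" and r s :: real
  show "x + y + z = x + (y + z)"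
    by transfer (auto simp: completion_rel_def ou_Cauchy_add add.assoc)
  show "x + y = y + x"
    by transfer (auto simp: completion_rel_def ou_Cauchy_add add.commute)
  show "0 + x = x"
    by transfer (auto simp: completion_rel_def)
  show "- x + x = 0"
    by transfer (auto simp: completion_rel_def)
  show "x - y = x + - y"
    by (rule minus_completion_def)
  show "r *\<^sub>R (x + y) = r *\<^sub>R x + r *\<^sub>R y"
    by transfer (auto simp: completion_rel_def scaleR_add_right ou_Cauchy_add ou_Cauchy_scaleR)
  show "(r + s) *\<^sub>R x = r *\<^sub>R x + s *\<^sub>R x"
    by transfer (auto simp: completion_rel_def scaleR_add_left ou_Cauchy_add ou_Cauchy_scaleR)
  show "r *\<^sub>R s *\<^sub>R x = (r * s) *\<^sub>R x"
    by transfer (auto simp: completion_rel_def ou_Cauchy_scaleR)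
  show "1 *\<^sub>R x = x"
    by transfer (auto simp: completion_rel_def)
  show "x < y \<longleftrightarrow> x \<le> y \<and> \<not> y \<le> x"
    by (rule less_completion_def)
  show "x \<le> x"
    by transfer (auto intro!: exI[of _ "\<lambda>n. 0"])
  show "x \<le> z" if "x \<le> y" "y \<le> z"
    using that
  proof transfer
    fix X Y Z :: "nat \<Rightarrow> 'a"
    assume "\<exists>P. (\<forall>n. 0 \<le> P n) \<and> (\<lambda>n. ou_norm (Y n - X n - P n)) \<longlonglongrightarrow> 0"
      and "\<exists>P. (\<forall>n. 0 \<le> P n) \<and> (\<lambda>n. ou_norm (Z n - Y n - P n)) \<longlonglongrightarrow> 0"
    then obtain P Q where "\<forall>n. 0 \<le> P n" "(\<lambda>n. ou_norm (Y n - X n - P n)) \<longlonglongrightarrow> 0"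
      "\<forall>n. 0 \<le> Q n" "(\<lambda>n. ou_norm (Z n - Y n - Q n)) \<longlonglongrightarrow> 0" by blast
    then show "\<exists>P. (\<forall>n. 0 \<le> P n) \<and> (\<lambda>n. ou_norm (Z n - X n - P n)) \<longlonglongrightarrow> 0"
      using ou_null_add[of "\<lambda>n. Y n - X n - P n" "\<lambda>n. Z n - Y n - Q n"]
      by (intro exI[of _ "\<lambda>n. P n + Q n"]) (simp add: algebra_simps)
  qed
  show "x = y" if "x \<le> y" "y \<le> x"
    using that
  proof transfer
    fix X Y :: "nat \<Rightarrow> 'a"
    assume c: "completion_rel X X" "completion_rel Y Y"
    assume "\<exists>P. (\<forall>n. 0 \<le> P n) \<and> (\<lambda>n. ou_norm (Y n - X n - P n)) \<longlonglongrightarrow> 0"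
      and "\<exists>P. (\<forall>n. 0 \<le> P n) \<and> (\<lambda>n. ou_norm (X n - Y n - P n)) \<longlonglongrightarrow> 0"
    then obtain P Q where P: "\<And>n. 0 \<le> P n" "(\<lambda>n. ou_norm (Y n - X n - P n)) \<longlonglongrightarrow> 0"
      and Q: "\<And>n. 0 \<le> Q n" "(\<lambda>n. ou_norm (X n - Y n - Q n)) \<longlonglongrightarrow> 0" by blast
    have "(\<lambda>n. ou_norm (- (P n + Q n))) \<longlonglongrightarrow> 0"
      using ou_null_add[OF P(2) Q(2)] by (simp add: algebra_simps)
    then have "(\<lambda>n. ou_norm (P n + Q n)) \<longlonglongrightarrow> 0" by (simp only: ou_norm_minus)
    then have "(\<lambda>n. ou_norm (P n)) \<longlonglongrightarrow> 0"
      by (rule ou_null_le) (simp add: ou_norm_mono P(1) Q(1))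
    from ou_null_add[OF P(2) this] have "(\<lambda>n. ou_norm (X n - Y n)) \<longlonglongrightarrow> 0"
      by (simp add: ou_norm_diff_commute)
    then show "completion_rel X Y" using c by (simp add: completion_rel_def)
  qed
  show "z + x \<le> z + y" if "x \<le> y"
    using that by transfer simp
  show "r *\<^sub>R x \<le> r *\<^sub>R y" if "x \<le> y" "0 \<le> r"
    using that
  proof transfer
    fix X Y :: "nat \<Rightarrow> 'a" and r :: real
    assume r: "0 \<le> r"
    assume "\<exists>P. (\<forall>n. 0 \<le> P n) \<and> (\<lambda>n. ou_norm (Y n - X n - P n)) \<longlonglongrightarrow> 0"
    then obtain P where "\<forall>n. 0 \<le> P n" "(\<lambda>n. ou_norm (Y n - X n - P n)) \<longlonglongrightarrow> 0" by blast
    then show "\<exists>P. (\<forall>n. 0 \<le> P n) \<and> (\<lambda>n. ou_norm (r *\<^sub>R Y n - r *\<^sub>R X n - P n)) \<longlonglongrightarrow> 0"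
      using ou_null_scaleR[of "\<lambda>n. Y n - X n - P n" r] r
      by (intro exI[of _ "\<lambda>n. r *\<^sub>R P n"]) (simp add: scaleR_diff_right scaleR_nonneg_nonneg)
  qed
  show "r *\<^sub>R x \<le> s *\<^sub>R x" if "r \<le> s" "0 \<le> x"
    using that
  proof transfer
    fix X :: "nat \<Rightarrow> 'a" and r s :: real
    assume rs: "r \<le> s"
    assume "\<exists>P. (\<forall>n. 0 \<le> P n) \<and> (\<lambda>n. ou_norm (X n - 0 - P n)) \<longlonglongrightarrow> 0"
    then obtain P where P: "\<forall>n. 0 \<le> P n" "(\<lambda>n. ou_norm (X n - P n)) \<longlonglongrightarrow> 0" by auto
    have "(s - r) *\<^sub>R (X n - P n) = s *\<^sub>R X n - r *\<^sub>R X n - (s - r) *\<^sub>R P n" for n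
      by (simp add: algebra_simps)
    then show "\<exists>P. (\<forall>n. 0 \<le> P n) \<and> (\<lambda>n. ou_norm (s *\<^sub>R X n - r *\<^sub>R X n - P n)) \<longlonglongrightarrow> 0"
      using ou_null_scaleR[OF P(2), of "s - r"] rs P(1)
      by (intro exI[of _ "\<lambda>n. (s - r) *\<^sub>R P n"]) (simp add: scaleR_nonneg_nonneg)
  qed
  show "0 \<le> (order_unit :: 'a completion)"
    by transfer (auto intro!: exI[of _ "\<lambda>n. order_unit"] simp: order_unit_nonneg)
  show "\<exists>r. x \<le> r *\<^sub>R order_unit"
  proof transfer
    fix X :: "nat \<Rightarrow> 'a" assume "completion_rel X X"
    then obtain M where M: "0 \<le> M" "\<And>n. ou_norm (X n) \<le> M"
      by (auto simp: completion_rel_def elim: ou_Cauchy_bounded)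
    have "X n \<le> M *\<^sub>R order_unit" for n
      by (rule order_trans[OF ou_norm_props(2) ou_scale_mono[OF M(2)]])
    then show "\<exists>r. \<exists>Z. (\<forall>n. 0 \<le> Z n) \<and> (\<lambda>n. ou_norm (r *\<^sub>R order_unit - X n - Z n)) \<longlonglongrightarrow> 0"
      by (intro exI[of _ M] exI[of _ "\<lambda>n. M *\<^sub>R order_unit - X n"]) simp
  qed
  show "x \<le> 0" if "\<And>r. 0 < r \<Longrightarrow> x \<le> r *\<^sub>R order_unit"
    using that
  proof transfer
    fix X :: "nat \<Rightarrow> 'a"
    assume X: "\<And>r. 0 < r \<Longrightarrow>
      \<exists>P. (\<forall>n. 0 \<le> P n) \<and> (\<lambda>n. ou_norm (r *\<^sub>R order_unit - X n - P n)) \<longlonglongrightarrow> 0"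
    have ev: "\<forall>\<^sub>F n in sequentially. X n \<le> \<epsilon> *\<^sub>R order_unit" if e: "0 < \<epsilon>" for \<epsilon>
    proof -
      obtain P where P: "\<And>n. 0 \<le> P n"
        "(\<lambda>n. ou_norm ((\<epsilon>/2) *\<^sub>R order_unit - X n - P n)) \<longlonglongrightarrow> 0"
        using X[of "\<epsilon>/2"] e by auto
      have "\<forall>\<^sub>F n in sequentially. ou_norm ((\<epsilon>/2) *\<^sub>R order_unit - X n - P n) < \<epsilon>/2"
        using order_tendstoD(2)[OF P(2), of "\<epsilon>/2"] e by simp
      then show ?thesis
      proof eventually_elim
        case (elim n)
        define w where "w = (\<epsilon>/2) *\<^sub>R order_unit - X n - P n"
        have "- ((\<epsilon>/2) *\<^sub>R order_unit) \<le> - (ou_norm w *\<^sub>R (order_unit::'a))"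
          using ou_scale_mono[of "ou_norm w" "\<epsilon>/2"] elim by (simp add: w_def)
        also have "\<dots> \<le> w" by (rule ou_norm_props(3))
        also have "\<dots> \<le> (\<epsilon>/2) *\<^sub>R order_unit - X n" using P(1)[of n] by (simp add: w_def)
        finally have "X n \<le> (\<epsilon>/2) *\<^sub>R order_unit + (\<epsilon>/2) *\<^sub>R order_unit"
          by (simp add: algebra_simps)
        then show ?case by (simp flip: scaleR_add_left)
      qed
    qed
    have "\<exists>d. 0 \<le> d \<and> X n \<le> d *\<^sub>R order_unit \<and>
        (\<forall>r. 0 \<le> r \<longrightarrow> X n \<le> r *\<^sub>R order_unit \<longrightarrow> d \<le> r)" for n
      by (rule ou_upper_attained[of "X n"]) blast
    then obtain d where d: "\<And>n. 0 \<le> d n" "\<And>n. X n \<le> d n *\<^sub>R order_unit"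
      "\<And>n r. 0 \<le> r \<Longrightarrow> X n \<le> r *\<^sub>R order_unit \<Longrightarrow> d n \<le> r"
      by metis
    have d0: "d \<longlonglongrightarrow> 0"
    proof (rule order_tendstoI)
      show "\<forall>\<^sub>F n in sequentially. a < d n" if "a < 0" for a
        using less_le_trans[OF that d(1)] by (intro always_eventually allI)
      show "\<forall>\<^sub>F n in sequentially. d n < a" if a: "0 < a" for a
      proof -
        have "d n < a" if "X n \<le> (a / 2) *\<^sub>R order_unit" for n
          using d(3)[OF _ that] a by linarith
        then show ?thesis using ev[of "a / 2"] a by (auto elim: eventually_mono)
      qed
    qed
    have "ou_norm (- (d n *\<^sub>R (order_unit::'a))) \<le> d n * ou_norm (order_unit::'a)" for n
      using ou_norm_scaleR_le[of "d n" "order_unit::'a"] d(1)[of n] by simp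
    then have "(\<lambda>n. ou_norm (- (d n *\<^sub>R (order_unit::'a)))) \<longlonglongrightarrow> 0"
      using tendsto_mult_left_zero[OF d0] by (rule ou_null_le[rotated])
    then show "\<exists>Z. (\<forall>n. 0 \<le> Z n) \<and> (\<lambda>n. ou_norm (0 - X n - Z n)) \<longlonglongrightarrow> 0"
      using d(2) by (intro exI[of _ "\<lambda>n. d n *\<^sub>R order_unit - X n"]) simp
  qed
qed

end

lift_definition completion_embed :: "'a::order_unit_space \<Rightarrow> 'a completion" is "\<lambda>a n. a"
  by (simp add: completion_rel_def)

lemma completion_embed_add: "completion_embed (a + b) = completion_embed a + completion_embed b"
  by transfer (simp add: completion_rel_def)

lemma completion_embed_scaleR: "completion_embed (r *\<^sub>R a) = r *\<^sub>R completion_embed a"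
  by transfer (simp add: completion_rel_def)

lemma completion_embed_minus: "completion_embed (- a) = - completion_embed a"
  by transfer (simp add: completion_rel_def)

lemma completion_embed_diff: "completion_embed (a - b) = completion_embed a - completion_embed b"
  using completion_embed_add[of a "- b"] by (simp add: completion_embed_minus)

lemma completion_embed_order_unit: "completion_embed order_unit = order_unit"
  by transfer (simp add: completion_rel_def)

lemma completion_embed_le_iff: "completion_embed a \<le> completion_embed b \<longleftrightarrow> a \<le> b"
proof
  assume "a \<le> b"
  then show "completion_embed a \<le> completion_embed b"
  proof transfer
    fix a b :: 'a assume "a \<le> b"
    then show "\<exists>Z. (\<forall>n. 0 \<le> Z n) \<and> (\<lambda>n::nat. ou_norm (b - a - Z n)) \<longlonglongrightarrow> 0"
      by (intro exI[of _ "\<lambda>n. b - a"]) simp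
  qed
next
  assume "completion_embed a \<le> completion_embed b"
  then obtain Z where Z: "\<And>n. 0 \<le> Z n" "(\<lambda>n. ou_norm (b - a - Z n)) \<longlonglongrightarrow> 0"
    by transfer auto
  have "a - b \<le> r *\<^sub>R order_unit" if r: "0 < r" for r
  proof -
    obtain n where n: "ou_norm (b - a - Z n) < r"
      using order_tendstoD(2)[OF Z(2) r] by (auto simp: eventually_sequentially)
    have "- (r *\<^sub>R order_unit) \<le> - (ou_norm (b - a - Z n) *\<^sub>R (order_unit::'a))"
      using ou_scale_mono[of "ou_norm (b - a - Z n)" r] n by simp
    also have "\<dots> \<le> b - a - Z n" by (rule ou_norm_props(3))
    also have "\<dots> \<le> b - a" using Z(1)[of n] by simp
    finally show ?thesis by (simp add: algebra_simps)
  qed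
  then have "a - b \<le> 0" by (rule order_unit_archimedean)
  then show "a \<le> b" by simp
qed

lemma ou_norm_embed: "ou_norm (completion_embed a) = ou_norm a"
  unfolding ou_norm_def
  by (simp flip: completion_embed_order_unit completion_embed_scaleR completion_embed_minus add: completion_embed_le_iff)

lemma completion_approx:
  fixes X :: "nat \<Rightarrow> 'a::order_unit_space"
  assumes X: "ou_Cauchy X" and \<delta>: "0 < \<delta>"
    and N: "\<And>m n. m \<ge> N \<Longrightarrow> n \<ge> N \<Longrightarrow> ou_norm (X m - X n) < \<delta>"
    and k: "k \<ge> N"
  shows "ou_norm (abs_completion X - completion_embed (X k)) \<le> \<delta>"
proof -
  have le: "X m - X n \<le> \<delta> *\<^sub>R order_unit" if "m \<ge> N" "n \<ge> N" for m n
    by (rule order_trans[OF ou_norm_props(2) ou_scale_mono[OF less_imp_le[OF N[OF that]]]])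
  have ex: "abs_completion W \<le> \<delta> *\<^sub>R order_unit"
    if c: "ou_Cauchy W" and W: "\<And>n. n \<ge> N \<Longrightarrow> W n \<le> \<delta> *\<^sub>R order_unit" for W :: "nat \<Rightarrow> 'a"
  proof -
    have "\<exists>Z. (\<forall>n. 0 \<le> Z n) \<and> (\<lambda>n. ou_norm (\<delta> *\<^sub>R order_unit - W n - Z n)) \<longlonglongrightarrow> 0"
    proof (intro exI conjI allI)
      show "0 \<le> (if n \<ge> N then \<delta> *\<^sub>R order_unit - W n else 0)" for n using W by simp
      show "(\<lambda>n. ou_norm (\<delta> *\<^sub>R order_unit - W n -
          (if n \<ge> N then \<delta> *\<^sub>R order_unit - W n else 0))) \<longlonglongrightarrow> 0"
        by (rule tendsto_eventually) (auto simp: eventually_sequentially intro: exI[of _ N])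
    qed
    then show ?thesis
      using c by (simp add: order_unit_completion_def scaleR_completion.abs_eq
          less_eq_completion.abs_eq completion_rel_def)
  qed
  have eq: "abs_completion X - completion_embed (X k) = abs_completion (\<lambda>n. X n - X k)"
    "completion_embed (X k) - abs_completion X = abs_completion (\<lambda>n. X k - X n)"
    using X by (simp_all add: minus_completion_def completion_embed.abs_eq uminus_completion.abs_eq
        plus_completion.abs_eq completion_rel_def ou_Cauchy_minus)
  have c: "ou_Cauchy (\<lambda>n. X n - X k)" "ou_Cauchy (\<lambda>n. X k - X n)"
    using ou_Cauchy_add[OF X ou_Cauchy_const[of "- X k"]]
      ou_Cauchy_add[OF ou_Cauchy_const[of "X k"] ou_Cauchy_minus[OF X]] by simp_all
  have "abs_completion X - completion_embed (X k) \<le> \<delta> *\<^sub>R order_unit"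
    "completion_embed (X k) - abs_completion X \<le> \<delta> *\<^sub>R order_unit"
    unfolding eq using c le k by (auto intro!: ex)
  then show ?thesis
    using \<delta> by (intro ou_norm_props(4)) (auto simp: minus_le_iff algebra_simps)
qed

lemma completion_limit:
  assumes X: "ou_Cauchy X"
  shows "(\<lambda>k. ou_norm (abs_completion X - completion_embed (X k))) \<longlonglongrightarrow> 0"
proof (rule LIMSEQ_I)
  fix \<epsilon> :: real assume \<epsilon>: "0 < \<epsilon>"
  then obtain N where N: "\<And>m n. m \<ge> N \<Longrightarrow> n \<ge> N \<Longrightarrow> ou_norm (X m - X n) < \<epsilon> / 2"
    using X unfolding ou_Cauchy_def by (meson half_gt_zero)
  have "norm (ou_norm (abs_completion X - completion_embed (X k)) - 0) < \<epsilon>" if "k \<ge> N" for k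
    using completion_approx[OF X _ N that] \<epsilon> ou_norm_props(1)[of "abs_completion X - completion_embed (X k)"]
    by simp
  then show "\<exists>N. \<forall>k\<ge>N. norm (ou_norm (abs_completion X - completion_embed (X k)) - 0) < \<epsilon>" by blast
qed

lemma completion_embed_dense:
  assumes "0 < \<epsilon>" shows "\<exists>a. ou_norm (x - completion_embed a) < \<epsilon>"
proof -
  obtain X where X: "ou_Cauchy X" "x = abs_completion X"
    by (induct x rule: completion.abs_induct) (auto simp: completion_rel_def)
  have "\<forall>\<^sub>F k in sequentially. ou_norm (x - completion_embed (X k)) < \<epsilon>"
    using order_tendstoD(2)[OF completion_limit[OF X(1)] assms] X(2) by simp
  then show ?thesis by (auto simp: eventually_sequentially)
qed

lemma completion_complete:
  fixes X :: "nat \<Rightarrow> 'a::order_unit_space completion"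
  assumes X: "ou_Cauchy X"
  shows "\<exists>x. (\<lambda>n. ou_norm (X n - x)) \<longlonglongrightarrow> 0"
proof -
  have "\<exists>a. ou_norm (X n - completion_embed a) < inverse (real (Suc n))" for n
    by (rule completion_embed_dense) simp
  then obtain A where A: "\<And>n. ou_norm (X n - completion_embed (A n)) < inverse (real (Suc n))"
    by metis
  have XA: "(\<lambda>n. ou_norm (X n - completion_embed (A n))) \<longlonglongrightarrow> 0"
    by (rule ou_null_le[OF LIMSEQ_inverse_real_of_nat]) (rule less_imp_le[OF A])
  have "ou_Cauchy A"
    unfolding ou_Cauchy_def
  proof (intro allI impI)
    fix \<epsilon> :: real assume "0 < \<epsilon>"
    then have \<epsilon>: "0 < \<epsilon> / 3" by simp
    obtain M where M: "\<forall>m\<ge>M. \<forall>n\<ge>M. ou_norm (X m - X n) < \<epsilon> / 3"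
      using X \<epsilon> unfolding ou_Cauchy_def by meson
    obtain N where N: "\<forall>n\<ge>N. ou_norm (X n - completion_embed (A n)) < \<epsilon> / 3"
      using order_tendstoD(2)[OF XA \<epsilon>] by (auto simp: eventually_sequentially)
    have "ou_norm (A m - A n) < \<epsilon>" if "m \<ge> max M N" "n \<ge> max M N" for m n
    proof -
      have "ou_norm (A m - A n) = ou_norm (completion_embed (A m) - completion_embed (A n))"
        by (simp flip: completion_embed_diff add: ou_norm_embed)
      also have "\<dots> \<le> ou_norm (completion_embed (A m) - X m) +
          (ou_norm (X m - X n) + ou_norm (X n - completion_embed (A n)))"
        using ou_norm_diff_triangle[of "completion_embed (A m)" "completion_embed (A n)" "X m"]
          ou_norm_diff_triangle[of "X m" "completion_embed (A n)" "X n"] by linarith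
      moreover have "ou_norm (X m - X n) < \<epsilon> / 3" "ou_norm (X n - completion_embed (A n)) < \<epsilon> / 3"
        "ou_norm (completion_embed (A m) - X m) < \<epsilon> / 3"
        using M N that by (auto simp: ou_norm_diff_commute[of "completion_embed (A m)"])
      ultimately show ?thesis by linarith
    qed
    then show "\<exists>N. \<forall>m\<ge>N. \<forall>n\<ge>N. ou_norm (A m - A n) < \<epsilon>" by blast
  qed
  from ou_null_add[OF XA ou_null_minus[OF completion_limit[OF this]]]
  have "(\<lambda>n. ou_norm (X n - abs_completion A)) \<longlonglongrightarrow> 0" by simp
  then show ?thesis ..
qed


text \<open>The paper's \<open>E\<close>, \<open>A\<^sup>c\<close> and \<open>L\<^sup>c\<close>.\<close>

definition closed_lip_ball :: "('a::order_unit_space \<Rightarrow> real) \<Rightarrow> 'a completion set" where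
  "closed_lip_ball L = {x. \<forall>\<epsilon>>0. \<exists>a. L a \<le> 1 \<and> ou_norm (x - completion_embed a) < \<epsilon>}"

definition closure_space :: "('a::order_unit_space \<Rightarrow> real) \<Rightarrow> 'a completion set" where
  "closure_space L = (\<Union>t\<in>{0<..}. (*\<^sub>R) t ` closed_lip_ball L)"

definition closure_norm :: "('a::order_unit_space \<Rightarrow> real) \<Rightarrow> 'a completion \<Rightarrow> real" where
  "closure_norm L x = Inf {t. 0 < t \<and> x \<in> (*\<^sub>R) t ` closed_lip_ball L}"

text \<open>Outside \<open>closure_space LA\<close> the values of \<open>\<phi>\<close> are irrelevant.\<close>

definition isometry ::
  "('a::order_unit_space \<Rightarrow> real) \<Rightarrow> ('b::order_unit_space \<Rightarrow> real) \<Rightarrow>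
   ('a completion \<Rightarrow> 'b completion) \<Rightarrow> bool" where
  "isometry LA LB \<phi> \<longleftrightarrow>
     bij_betw \<phi> (closure_space LA) (closure_space LB) \<and>
     (\<forall>x\<in>closure_space LA. \<forall>y\<in>closure_space LA. \<phi> (x + y) = \<phi> x + \<phi> y) \<and>
     (\<forall>r. \<forall>x\<in>closure_space LA. \<phi> (r *\<^sub>R x) = r *\<^sub>R \<phi> x) \<and>
     (\<forall>x\<in>closure_space LA. \<forall>y\<in>closure_space LA. \<phi> x \<le> \<phi> y \<longleftrightarrow> x \<le> y) \<and>
     \<phi> order_unit = order_unit \<and>
     (\<forall>x\<in>closure_space LA. closure_norm LA x = closure_norm LB (\<phi> x))"

end

theory Submission
  imports Defs
begin

text \<open>
  A Lip-norm \<open>L\<close> on \<open>A \<oplus> B\<close> of Hausdorff distance less than \<open>\<epsilon>\<close> relates \<open>a\<close> and \<open>b\<close> with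
  \<open>L (a, b) \<le> t\<close>: every state of \<open>B\<close> is \<open>\<epsilon>\<close>-close to a state of \<open>A\<close> and conversely, so the
  relation preserves the order up to \<open>\<epsilon> t\<close>, because states determine the order.  Take such
  \<open>L\<^sub>n\<close> with \<open>\<epsilon> = 1 / (n + 1)\<close> and relate \<open>x\<close> to \<open>y\<close> in the completions if they are the limits,
  along a fixed nonprincipal ultrafilter, of \<open>a\<^sub>n\<close> and \<open>b\<^sub>n\<close> with \<open>L\<^sub>n (a\<^sub>n, b\<^sub>n)\<close> bounded.  This
  relation is linear, and \<open>x \<ge> 0\<close> holds iff \<open>y \<ge> 0\<close>, hence it is the graph of an injective map.  Since
  \<open>L\<^sub>n\<close> induces \<open>L\<^sub>A\<close> and \<open>L\<^sub>B\<close>, and norm-bounded sets with bounded Lip-norm are totally bounded,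
  the relation matches \<open>t E\<^sub>A\<close> with \<open>t E\<^sub>B\<close> for every \<open>t > 0\<close>.
\<close>

subsection \<open>Ultrafilters\<close>

text \<open>Zorn's lemma for the reversed order. Nonemptiness of \<open>A\<close> settles the empty
  chain, so applications only have to bound nonempty chains from below.\<close>

lemma zorn_minimal:
  fixes A :: "'a::order set"
  assumes ne: "A \<noteq> {}"
    and ch: "\<And>C. \<lbrakk>C \<subseteq> A; C \<noteq> {}; \<And>x y. x \<in> C \<Longrightarrow> y \<in> C \<Longrightarrow> x \<le> y \<or> y \<le> x\<rbrakk> \<Longrightarrow> \<exists>l\<in>A. \<forall>x\<in>C. l \<le> x"
  shows "\<exists>m\<in>A. \<forall>x\<in>A. x \<le> m \<longrightarrow> x = m"
proof -
  have "\<exists>m\<in>A. \<forall>a\<in>A. m \<ge> a \<longrightarrow> a = m"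
  proof (rule predicate_Zorn)
    show "partial_order_on A (relation_of (\<ge>) A)"
      by (auto simp: partial_order_on_def preorder_on_def refl_on_def trans_def antisym_def relation_of_def)
    show "\<exists>u\<in>A. \<forall>a\<in>C. a \<ge> u" if "C \<in> Chains (relation_of (\<ge>) A)" for C
    proof (cases "C = {}")
      case False
      have "C \<subseteq> A" "\<And>x y. x \<in> C \<Longrightarrow> y \<in> C \<Longrightarrow> x \<le> y \<or> y \<le> x"
        using that by (auto simp: Chains_def relation_of_def)
      with False show ?thesis using ch by blast
    qed (use ne in auto)
  qed
  then show ?thesis by blast
qed

text \<open>A minimal proper filter below \<open>F\<close> decides every predicate: a proper
  restriction of it to the predicate cannot be strictly finer.\<close>

lemma ultrafilter_exists:
  fixes F :: "'a filter"
  assumes "F \<noteq> bot"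
  obtains U where "U \<le> F" "U \<noteq> bot" "\<And>P. eventually P U \<or> eventually (\<lambda>x. \<not> P x) U"
proof -
  define A where "A = {G. G \<le> F \<and> G \<noteq> bot}"
  have "\<exists>U\<in>A. \<forall>G\<in>A. G \<le> U \<longrightarrow> G = U"
  proof (rule zorn_minimal)
    show "A \<noteq> {}" using assms by (auto simp: A_def)
    fix C assume C: "C \<subseteq> A" "C \<noteq> {}" "\<And>x y. x \<in> C \<Longrightarrow> y \<in> C \<Longrightarrow> x \<le> y \<or> y \<le> x"
    \<comment> \<open>A chain is directed, so whatever holds eventually along \<open>Inf C\<close>
      already does so along a single member. Hence the infimum stays proper.\<close>
    have "\<exists>H\<in>C. H \<le> inf G G'" if "G \<in> C" "G' \<in> C" for G G'
      using C(3)[OF that] that by auto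
    then have "eventually P (Inf C) \<longleftrightarrow> (\<exists>G\<in>C. eventually P G)" for P
      by (rule eventually_Inf_base[OF C(2)])
    then have "Inf C \<noteq> bot" using C(1) by (auto simp: A_def trivial_limit_def)
    moreover have "Inf C \<le> F" using C(1,2) by (auto simp: A_def intro: Inf_lower2)
    ultimately have "Inf C \<in> A" by (simp add: A_def)
    then show "\<exists>l\<in>A. \<forall>x\<in>C. l \<le> x" by (meson Inf_lower)
  qed
  then obtain U where U: "U \<in> A" "\<And>G. G \<in> A \<Longrightarrow> G \<le> U \<Longrightarrow> G = U" by blast
  have "eventually P U \<or> eventually (\<lambda>x. \<not> P x) U" for P
  \<comment> \<open>If the restriction of \<open>U\<close> to \<open>P\<close> is trivial, the
    negation of \<open>P\<close> is eventual; otherwise minimality identifies the restriction with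
    \<open>U\<close>.\<close>
  proof (cases "inf U (principal {x. P x}) = bot")
    case True
    then show ?thesis by (auto simp: trivial_limit_def eventually_inf_principal)
  next
    case False
    then have "inf U (principal {x. P x}) = U"
      using U(1) by (intro U(2)) (auto simp: A_def intro: le_infI1)
    moreover have "eventually P (inf U (principal {x. P x}))" by (simp add: eventually_inf_principal)
    ultimately show ?thesis by simp
  qed
  with U(1) that show thesis by (auto simp: A_def)
qed

text \<open>Compactness gives a cluster point of the image filter. For an ultrafilter a cluster
  point is a limit: if a neighbourhood were not eventual, its complement would be.\<close>

lemma ultrafilter_limit_compact:
  fixes f :: "'i \<Rightarrow> 'a::topological_space"
  assumes U: "U \<noteq> bot" "\<And>P. eventually P U \<or> eventually (\<lambda>i. \<not> P i) U"
    and K: "compact K" "\<And>i. f i \<in> K"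
  shows "\<exists>l. (f \<longlongrightarrow> l) U"
proof -
  have "filtermap f U \<noteq> bot" "eventually (\<lambda>x. x \<in> K) (filtermap f U)"
    using U(1) K(2) by (auto simp: filtermap_bot_iff eventually_filtermap)
  then obtain l where l: "inf (nhds l) (filtermap f U) \<noteq> bot"
    using K(1) unfolding compact_filter by blast
  have "(f \<longlongrightarrow> l) U"
  proof (rule topological_tendstoI, rule ccontr)
    fix S assume S: "open S" "l \<in> S" "\<not> eventually (\<lambda>i. f i \<in> S) U"
    then have "eventually (\<lambda>i. f i \<notin> S) U" using U(2) by blast
    then have "eventually (\<lambda>x. x \<notin> S) (filtermap f U)" by (simp add: eventually_filtermap)
    moreover have "eventually (\<lambda>x. x \<in> S) (nhds l)" using S by (auto intro: eventually_nhds_in_open)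
    ultimately have "eventually (\<lambda>x. False) (inf (nhds l) (filtermap f U))"
      unfolding eventually_inf by blast
    then show False using l by (simp add: trivial_limit_def)
  qed
  then show ?thesis ..
qed

subsection \<open>Linear functionals below sublinear ones\<close>

definition sublinear :: "('a::real_vector \<Rightarrow> real) \<Rightarrow> bool" where
  "sublinear p \<longleftrightarrow> (\<forall>x y. p (x + y) \<le> p x + p y) \<and> (\<forall>r\<ge>0. \<forall>x. p (r *\<^sub>R x) = r * p x)"

lemma sublinearD:
  assumes "sublinear p"
  shows "p (x + y) \<le> p x + p y" "0 \<le> r \<Longrightarrow> p (r *\<^sub>R x) = r * p x" "p 0 = 0" "- p (- x) \<le> p x"
proof -
  show a: "p (x + y) \<le> p x + p y" "0 \<le> r \<Longrightarrow> p (r *\<^sub>R x) = r * p x" for x y r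
    using assms by (auto simp: sublinear_def)
  show "p 0 = 0" using a(2)[of 0 0] by simp
  then show "- p (- x) \<le> p x" using a(1)[of x "- x"] by simp
qed

text \<open>One inequality for positive scalars suffices, because applying it to
  \<open>inverse r\<close> gives the other.\<close>

lemma sublinearI:
  assumes "\<And>x y. p (x + y) \<le> p x + p y" "p 0 = 0" "\<And>r x. 0 < r \<Longrightarrow> p (r *\<^sub>R x) \<le> r * p x"
  shows "sublinear p"
  unfolding sublinear_def
proof (intro conjI allI impI)
  show "p (r *\<^sub>R x) = r * p x" if "0 \<le> r" for r x
  proof (cases "r = 0")
    case False
    then have "r * p x \<le> p (r *\<^sub>R x)"
      using assms(3)[of "inverse r" "r *\<^sub>R x"] that by (simp add: field_simps)
    then show ?thesis using assms(3)[of r x] that False by simp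
  qed (simp add: assms)
qed (rule assms)

text \<open>The decrease of \<open>p\<close> used both to start the Hahn--Banach argument in a prescribed direction
  and to see that a minimal sublinear functional is additive.\<close>

lemma sublinear_decrease:
  fixes y :: "'a::real_vector"
  assumes p: "sublinear p"
  obtains q where "sublinear q" "\<And>x t. 0 \<le> t \<Longrightarrow> q x \<le> p (x + t *\<^sub>R y) - t * p y"
proof -
  define f where "f t x = p (x + t *\<^sub>R y) - t * p y" for t x
  define q where "q x = (INF t\<in>{0..}. f t x)" for x
  \<comment> \<open>A lower bound independent of \<open>t\<close>, from writing
    \<open>t *\<^sub>R y\<close> as the sum of \<open>x + t *\<^sub>R y\<close> and
    \<open>- x\<close>; it makes the infimum \<open>q\<close> meaningful.\<close>
  have "- p (- x) \<le> f t x" if "0 \<le> t" for t x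
    using sublinearD(1)[OF p, of "x + t *\<^sub>R y" "- x"] sublinearD(2)[OF p that, of y]
    by (simp add: f_def)
  then have bdd: "bdd_below ((\<lambda>t. f t x) ` {0..})" for x by (auto intro!: bdd_belowI2)
  have le: "q x \<le> f t x" if "0 \<le> t" for t x
    unfolding q_def using bdd that by (intro cINF_lower) auto
  have ge: "c \<le> q x" if "\<And>t. 0 \<le> t \<Longrightarrow> c \<le> f t x" for c x
    unfolding q_def using that by (intro cINF_greatest) auto
  have "sublinear q"
  proof (rule sublinearI)
    fix u v
    \<comment> \<open>The parameters of the two summands add up. The infimum is then taken over
      \<open>t\<close> and over \<open>s\<close> separately.\<close>
    have "q (u + v) \<le> f s u + f t v" if "0 \<le> s" "0 \<le> t" for s t
      using le[of "s + t" "u + v"] sublinearD(1)[OF p, of "u + s *\<^sub>R y" "v + t *\<^sub>R y"] that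
      by (simp add: f_def algebra_simps)
    then have "q (u + v) - f s u \<le> f t v" if "0 \<le> s" "0 \<le> t" for s t
      using that by (metis add.commute diff_le_eq)
    then have "q (u + v) - f s u \<le> q v" if "0 \<le> s" for s
      using that by (intro ge)
    then have "q (u + v) - q v \<le> f s u" if "0 \<le> s" for s using that by (simp add: algebra_simps)
    then show "q (u + v) \<le> q u + q v" using ge[of "q (u + v) - q v" u] by simp
  next
    have "f t 0 = 0" if "0 \<le> t" for t using sublinearD(2)[OF p that, of y] by (simp add: f_def)
    then show "q 0 = 0" using le[of 0 0] ge[of 0 0] by simp
  next
    fix r :: real and x assume r: "0 < r"
    have *: "f (r * t) (r *\<^sub>R x) = r * f t x" for t
      using sublinearD(2)[OF p, of r "x + t *\<^sub>R y"] r by (simp add: f_def algebra_simps)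
    have "q (r *\<^sub>R x) / r \<le> f t x" if "0 \<le> t" for t
      using le[of "r * t" "r *\<^sub>R x"] r that by (simp only: * pos_divide_le_eq mult.commute[of _ r] mult_nonneg_nonneg less_imp_le)
    then have "q (r *\<^sub>R x) / r \<le> q x" by (rule ge)
    then show "q (r *\<^sub>R x) \<le> r * q x" using r by (simp add: field_simps)
  qed
  then show thesis using le that unfolding f_def by blast
qed

text \<open>Hahn-Banach by minimality: a minimal sublinear functional cannot be decreased in any
  direction and is therefore linear. Starting below the decrease \<open>p'\<close> of
  \<open>p\<close> in direction \<open>y\<close> forces the value at \<open>y\<close>.\<close>

lemma linear_below_sublinear:
  assumes p: "sublinear p"
  obtains \<mu> where "linear \<mu>" "\<And>x. \<mu> x \<le> p x" "\<mu> y = p y"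
proof -
  obtain p' where p': "sublinear p'" "\<And>x t. 0 \<le> t \<Longrightarrow> p' x \<le> p (x + t *\<^sub>R y) - t * p y"
    using sublinear_decrease[OF p] by blast
  define A where "A = {q. sublinear q \<and> q \<le> p'}"
  have "\<exists>m\<in>A. \<forall>q\<in>A. q \<le> m \<longrightarrow> q = m"
  proof (rule zorn_minimal)
    show "A \<noteq> {}" using p'(1) by (auto simp: A_def)
    fix C assume C: "C \<subseteq> A" "C \<noteq> {}" "\<And>x y. x \<in> C \<Longrightarrow> y \<in> C \<Longrightarrow> x \<le> y \<or> y \<le> x"
    define l where "l x = (INF q\<in>C. q x)" for x
    have sub: "sublinear q" "q \<le> p'" if "q \<in> C" for q using that C(1) by (auto simp: A_def)
    \<comment> \<open>All members of the chain share this lower bound, so their pointwise infimum is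
      finite.\<close>
    have "- p' (- x) \<le> q x" if "q \<in> C" for q x
      using sublinearD(4)[OF sub(1)[OF that], of x] le_funD[OF sub(2)[OF that], of "- x"] by simp
    then have bdd: "bdd_below ((\<lambda>q. q x) ` C)" for x by (auto intro!: bdd_belowI2)
    have le: "l x \<le> q x" if "q \<in> C" for q x
      unfolding l_def using bdd that by (intro cINF_lower) auto
    have ge: "c \<le> l x" if "\<And>q. q \<in> C \<Longrightarrow> c \<le> q x" for c x
      unfolding l_def using that C(2) by (intro cINF_greatest) auto
    have "sublinear l"
    proof (rule sublinearI)
      fix u v
      \<comment> \<open>The smaller of \<open>q\<close> and \<open>q'\<close> is subadditive and
        lies below both, which lets the two summands use different members of the chain.\<close>
      have "l (u + v) \<le> q u + q' v" if q: "q \<in> C" "q' \<in> C" for q q'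
      proof -
        obtain s where "s \<in> C" "s \<le> q" "s \<le> q'" using C(3)[OF q] q by auto
        then show ?thesis
          using le[of s "u + v"] sublinearD(1)[OF sub(1), of s u v] le_funD[of s q u] le_funD[of s q' v]
          by simp
      qed
      then have "l (u + v) - q u \<le> q' v" if "q \<in> C" "q' \<in> C" for q q'
        using that by (metis add.commute diff_le_eq)
      then have *: "l (u + v) - q u \<le> l v" if "q \<in> C" for q
        using that by (intro ge)
      have "l (u + v) - l v \<le> q u" if "q \<in> C" for q using *[OF that] by simp
      then show "l (u + v) \<le> l u + l v" using ge[of "l (u + v) - l v" u] by simp
    next
      show "l 0 = 0"
        using C(2) le[of _ 0] ge[of 0 0] sublinearD(3)[OF sub(1)] by (metis equals0I order_antisym order_refl)
    next
      fix r :: real and x assume r: "0 < r"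
      have "l (r *\<^sub>R x) / r \<le> q x" if "q \<in> C" for q
        using le[OF that, of "r *\<^sub>R x"] sublinearD(2)[OF sub(1)[OF that], of r x] r
        by (simp add: field_simps)
      then have "l (r *\<^sub>R x) / r \<le> l x" by (rule ge)
      then show "l (r *\<^sub>R x) \<le> r * l x" using r by (simp add: field_simps)
    qed
    moreover have "l \<le> p'"
      using C(2) le sub(2) by (metis equals0I le_fun_def order_trans)
    ultimately have "l \<in> A" by (simp add: A_def)
    then show "\<exists>l\<in>A. \<forall>x\<in>C. l \<le> x" using le by (auto simp: le_fun_def)
  qed
  then obtain m where m: "sublinear m" "m \<le> p'" and min: "\<And>q. sublinear q \<Longrightarrow> q \<le> m \<Longrightarrow> q = m"
    unfolding A_def by (metis (no_types, lifting) mem_Collect_eq order_trans)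
  have add: "m (u + v) = m u + m v" for u v
  proof -
    obtain q where q: "sublinear q" "\<And>x t. 0 \<le> t \<Longrightarrow> q x \<le> m (x + t *\<^sub>R v) - t * m v"
      using sublinear_decrease[OF m(1)] by blast
    \<comment> \<open>The instance \<open>t = 0\<close> puts \<open>q\<close> below
      \<open>m\<close>, so minimality makes them equal; the instance \<open>t = 1\<close> then gives
      superadditivity.\<close>
    have "q = m" using q(2)[of 0] by (intro min q(1)) (simp add: le_fun_def)
    then have "m u \<le> m (u + v) - m v" using q(2)[of 1 u] by simp
    then show ?thesis using sublinearD(1)[OF m(1), of u v] by simp
  qed
  have neg: "m (- x) = - m x" for x
    using add[of x "- x"] sublinearD(3)[OF m(1)] by simp
  have "m (r *\<^sub>R x) = r * m x" for r x
    using sublinearD(2)[OF m(1), of r x] sublinearD(2)[OF m(1), of "- r" x] neg[of "r *\<^sub>R x"]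
    by (cases "0 \<le> r") auto
  then have lin: "linear m" by (intro linearI) (simp_all add: add)
  moreover have le: "m x \<le> p x" for x using le_funD[OF m(2), of x] p'(2)[of 0 x] by simp
  \<comment> \<open>At \<open>- y\<close> with \<open>t = 1\<close> the decrease gives
    \<open>p' (- y) \<le> - p y\<close>, hence \<open>p y \<le> m y\<close>.\<close>
  moreover have "m y = p y"
    using le_funD[OF m(2), of "- y"] p'(2)[of 1 "- y"] neg[of y] le[of y] sublinearD(3)[OF p] by simp
  ultimately show thesis by (rule that)
qed

subsection \<open>States\<close>

lemma seminormD:
  assumes "seminorm L"
  shows "L (a + b) \<le> L a + L b" "L (r *\<^sub>R a) = \<bar>r\<bar> * L a" "L 0 = 0" "L (- a) = L a" "0 \<le> L a"
proof -
  have add: "L (a + b) \<le> L a + L b" for a b using assms by (simp add: seminorm_def)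
  have scale: "L (r *\<^sub>R a) = \<bar>r\<bar> * L a" for r a using assms by (simp add: seminorm_def)
  show "L (a + b) \<le> L a + L b" "L (r *\<^sub>R a) = \<bar>r\<bar> * L a" by (rule add scale)+
  show z: "L 0 = 0" using scale[of 0 0] by simp
  have m: "L (- a) = L a" for a using scale[of "-1" a] by simp
  show "L (- a) = L a" by (rule m)
  show "0 \<le> L a" using add[of a "- a"] by (simp add: z m)
qed

text \<open>This trades the dual norm for a pointwise bound. Membership in \<open>ou_dual\<close>
  makes the real supremum a true upper bound; conversely the order unit attains the value 1.\<close>

lemma states_iff:
  "\<mu> \<in> states \<longleftrightarrow> linear \<mu> \<and> \<mu> order_unit = 1 \<and> (\<forall>a. \<bar>\<mu> a\<bar> \<le> ou_norm (a :: 'a::order_unit_space))"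
proof safe
  assume \<mu>: "\<mu> \<in> states"
  then obtain K where K: "\<And>a. \<bar>\<mu> a\<bar> \<le> ou_norm a * K" and lin: "linear \<mu>"
    and one: "\<mu> order_unit = 1" and dn: "dual_norm \<mu> = 1"
    by (auto simp: states_def ou_dual_def)
  show "linear \<mu>" "\<mu> order_unit = 1" by fact+
  have "\<bar>\<mu> a\<bar> \<le> \<bar>K\<bar>" if "ou_norm a \<le> 1" for a
  proof -
    have "\<bar>\<mu> a\<bar> \<le> ou_norm a * \<bar>K\<bar>"
      using K[of a] by (meson abs_ge_self mult_left_mono order_trans ou_norm_props(1))
    also have "\<dots> \<le> 1 * \<bar>K\<bar>" using that by (intro mult_right_mono) auto
    finally show ?thesis by simp
  qed
  then have "bdd_above ((\<lambda>a. \<bar>\<mu> a\<bar>) ` {a. ou_norm a \<le> 1})" by (auto intro!: bdd_aboveI2)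
  then have "\<bar>\<mu> a\<bar> \<le> dual_norm \<mu>" if "ou_norm a \<le> 1" for a
    using that unfolding dual_norm_def by (intro cSUP_upper) auto
  with dn have le1: "\<bar>\<mu> a\<bar> \<le> 1" if "ou_norm a \<le> 1" for a using that by simp
  fix a
  show "\<bar>\<mu> a\<bar> \<le> ou_norm a"
  proof (cases "a = 0")
    case False
    then have pos: "0 < ou_norm a" using ou_norm_props(1)[of a] ou_norm_eq_0_iff[of a] by linarith
    then have "ou_norm (inverse (ou_norm a) *\<^sub>R a) \<le> 1"
      using order_trans[OF ou_norm_scaleR_le[of "inverse (ou_norm a)" a], of 1] False by simp
    from le1[OF this] show ?thesis
      using pos by (simp add: linear_scale[OF lin] abs_mult field_simps)
  qed (simp add: linear_0[OF lin])
next
  assume \<mu>: "linear \<mu>" "\<mu> order_unit = 1" "\<forall>a. \<bar>\<mu> a\<bar> \<le> ou_norm a"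
  have "ou_norm (order_unit :: 'a) \<le> 1"
    using order_unit_nonneg[where 'a = 'a] by (intro ou_norm_props(4)) (auto intro: order_trans[of _ 0])
  then have "1 \<in> (\<lambda>a. \<bar>\<mu> a\<bar>) ` {a. ou_norm a \<le> 1}"
    using \<mu>(2) by (intro image_eqI[of _ _ order_unit]) auto
  then have "dual_norm \<mu> = 1"
    unfolding dual_norm_def using \<mu>(3) by (intro cSup_eq_maximum) (auto intro: order_trans)
  moreover have "\<mu> \<in> ou_dual"
    unfolding ou_dual_def using \<mu>(1,3) by (auto intro: exI[of _ 1])
  ultimately show "\<mu> \<in> states" using \<mu>(2) by (simp add: states_def)
qed

lemma statesD:
  assumes "\<mu> \<in> states"
  shows "linear \<mu>" "\<mu> order_unit = 1" "\<bar>\<mu> a\<bar> \<le> ou_norm a"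
  using assms by (auto simp: states_iff)

text \<open>With \<open>r\<close> the norm of \<open>a\<close>, positivity of \<open>a\<close> gives
  \<open>r *\<^sub>R order_unit - a\<close> norm at most \<open>r\<close>, so
  \<open>r - \<mu> a \<le> r\<close>.\<close>

lemma states_nonneg:
  fixes a :: "'a::order_unit_space"
  assumes \<mu>: "\<mu> \<in> states" and a: "0 \<le> a"
  shows "0 \<le> \<mu> a"
proof -
  let ?r = "ou_norm a"
  have "0 \<le> ?r *\<^sub>R order_unit - a" "?r *\<^sub>R order_unit - a \<le> ?r *\<^sub>R order_unit"
    "- (?r *\<^sub>R order_unit) \<le> (0::'a)"
    using a ou_norm_props(2)[of a] ou_scale_mono[OF ou_norm_props(1)[of a], where 'a = 'a] by auto
  then have "ou_norm (?r *\<^sub>R order_unit - a) \<le> ?r"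
    by (intro ou_norm_props(4) ou_norm_props(1)) (rule order_trans)
  then have "\<bar>\<mu> (?r *\<^sub>R order_unit - a)\<bar> \<le> ?r" using statesD(3)[OF \<mu>] order_trans by blast
  then show ?thesis
    by (simp add: linear_diff[OF statesD(1)[OF \<mu>]] linear_scale[OF statesD(1)[OF \<mu>]] statesD(2)[OF \<mu>])
qed

text \<open>The least \<open>r \<ge> 0\<close> with \<open>x \<le> r *\<^sub>R order_unit\<close> is
  sublinear in \<open>x\<close>, and nonzero at \<open>- a\<close> when \<open>a\<close> is not
  positive. A linear functional below it with the same value at \<open>- a\<close> becomes, after
  normalisation, a state that is negative at \<open>a\<close>.\<close>

lemma nonneg_if_states_nonneg:
  fixes a :: "'a::order_unit_space"
  assumes "\<And>\<mu>. \<mu> \<in> states \<Longrightarrow> 0 \<le> \<mu> a"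
  shows "0 \<le> a"
proof (rule ccontr)
  assume na: "\<not> 0 \<le> a"
  have "\<exists>d\<ge>0. x \<le> d *\<^sub>R order_unit \<and> (\<forall>r\<ge>0. x \<le> r *\<^sub>R order_unit \<longrightarrow> d \<le> r)" for x :: 'a
    by (rule ou_upper_attained[of x]) blast
  then obtain p where p: "\<And>x::'a. 0 \<le> p x" "\<And>x::'a. x \<le> p x *\<^sub>R order_unit"
    "\<And>(x::'a) r. 0 \<le> r \<Longrightarrow> x \<le> r *\<^sub>R order_unit \<Longrightarrow> p x \<le> r"
    by metis
  have "sublinear p"
  proof (rule sublinearI)
    show "p (x + y) \<le> p x + p y" for x y
      using add_mono[OF p(2)[of x] p(2)[of y]] p(1)[of x] p(1)[of y]
      by (intro p(3)) (auto simp: scaleR_add_left)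
    show "p 0 = 0" using p(1)[of 0] p(3)[of 0 0] by simp
    show "p (r *\<^sub>R x) \<le> r * p x" if "0 < r" for r x
      using scaleR_left_mono[OF p(2)[of x], of r] p(1)[of x] that by (intro p(3)) auto
  qed
  then obtain \<mu> where \<mu>: "linear \<mu>" "\<And>x. \<mu> x \<le> p x" "\<mu> (- a) = p (- a)"
    using linear_below_sublinear[where y = "- a"] by blast
  have "p (- a) \<noteq> 0" using p(2)[of "- a"] na by auto
  then have neg: "\<mu> a < 0" using \<mu>(3) p(1)[of "- a"] by (simp add: linear_neg[OF \<mu>(1)])
  \<comment> \<open>The sublinear functional vanishes on the negative cone, so \<open>\<mu>\<close>
    is a positive functional.\<close>
  have nonpos: "\<mu> x \<le> 0" if "x \<le> 0" for x
    using p(3)[of 0 x] \<mu>(2)[of x] that by simp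
  define m where "m = \<mu> order_unit"
  have le: "\<mu> x \<le> ou_norm x * m" for x
    using nonpos[of "x - ou_norm x *\<^sub>R order_unit"] ou_norm_props(2)[of x]
    by (simp add: m_def linear_diff[OF \<mu>(1)] linear_scale[OF \<mu>(1)])
  have bound: "\<bar>\<mu> x\<bar> \<le> ou_norm x * m" for x
    using le[of x] le[of "- x"] by (simp add: linear_neg[OF \<mu>(1)])
  \<comment> \<open>If \<open>m\<close> were zero, \<open>bound\<close> would force
    \<open>\<mu>\<close> to vanish, but \<open>\<mu> a\<close> is negative.\<close>
  have "0 < m"
    using bound[of a] neg nonpos[of "- order_unit"] order_unit_nonneg[where 'a = 'a]
    by (cases "m = 0") (auto simp: m_def linear_neg[OF \<mu>(1)])
  moreover have "linear (\<lambda>x. \<mu> x / m)"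
    by (intro linearI) (simp_all add: linear_add[OF \<mu>(1)] linear_scale[OF \<mu>(1)] add_divide_distrib)
  ultimately have "(\<lambda>x. \<mu> x / m) \<in> states"
    using bound by (auto simp: states_iff m_def[symmetric] field_simps)
  from assms[OF this] show False using neg \<open>0 < m\<close> by (simp add: zero_le_divide_iff)
qed

text \<open>States detect the positivity of \<open>r *\<^sub>R order_unit - c\<close> and of
  \<open>c + r *\<^sub>R order_unit\<close>. The sign of \<open>r\<close> is assumed because the
  zero space has no states to enforce it.\<close>

lemma ou_norm_le_if_states_le:
  fixes c :: "'a::order_unit_space"
  assumes r: "0 \<le> r" and le: "\<And>\<mu>. \<mu> \<in> states \<Longrightarrow> \<bar>\<mu> c\<bar> \<le> r"
  shows "ou_norm c \<le> r"
proof -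
  have "0 \<le> r *\<^sub>R order_unit - c" "0 \<le> c + r *\<^sub>R order_unit"
  proof (rule_tac [!] nonneg_if_states_nonneg)
    fix \<mu> :: "'a \<Rightarrow> real" assume \<mu>: "\<mu> \<in> states"
    note lin = statesD(1)[OF \<mu>]
    show "0 \<le> \<mu> (r *\<^sub>R order_unit - c)" "0 \<le> \<mu> (c + r *\<^sub>R order_unit)"
      using le[OF \<mu>] by (simp_all add: linear_diff[OF lin] linear_add[OF lin] linear_scale[OF lin] statesD(2)[OF \<mu>])
  qed
  then show ?thesis using r by (intro ou_norm_props(4)) (auto simp: minus_le_iff algebra_simps simp flip: neg_le_0_iff_le[of "c + r *\<^sub>R order_unit"])
qed

text \<open>The Banach-Alaoglu argument: the states form a closed subset of a product of compact
  intervals, which is compact by Tychonoff's theorem.\<close>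

lemma compactin_states: "compactin weak_star_states (states :: ('a::order_unit_space \<Rightarrow> real) set)"
proof -
  have eq: "(states :: ('a \<Rightarrow> real) set) = {\<mu>. (\<forall>a b. \<mu> (a + b) = \<mu> a + \<mu> b) \<and>
      (\<forall>r a. \<mu> (r *\<^sub>R a) = r * \<mu> a) \<and> \<mu> order_unit = 1 \<and> (\<forall>a. \<bar>\<mu> a\<bar> \<le> ou_norm a)}"
    by (auto simp: states_iff linear_iff)
  have cl: "closed (states :: ('a \<Rightarrow> real) set)"
    unfolding eq by (intro closed_Collect_conj closed_Collect_all closed_Collect_eq closed_Collect_le
        continuous_intros continuous_on_product_coordinates)
  have "compactin (product_topology (\<lambda>_. euclideanreal) UNIV) (PiE UNIV (\<lambda>a::'a. {- ou_norm a..ou_norm a}))"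
    by (auto simp: compactin_PiE)
  then have "compact (PiE UNIV (\<lambda>a::'a. {- ou_norm a..ou_norm a}))"
    by (simp add: euclidean_product_topology)
  moreover have "states \<subseteq> PiE UNIV (\<lambda>a::'a. {- ou_norm a..ou_norm a})"
    by (auto simp: states_iff abs_le_iff minus_le_iff)
  ultimately have "compact (states :: ('a \<Rightarrow> real) set)"
    using cl by (metis compact_Int_closed inf.absorb_iff2)
  then show ?thesis
    unfolding weak_star_states_def by (simp add: compactin_subtopology euclidean_product_topology)
qed

section \<open>The metric of a seminorm on states and its total boundedness for Lip-norms\<close>

lemma rho_triangle: "rho L \<mu> \<nu> \<le> rho L \<mu> \<kappa> + rho L \<kappa> \<nu>"
  unfolding rho_def
proof (rule SUP_least)
  fix a assume a: "a \<in> {a. L a \<le> 1}"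
  have "ennreal \<bar>\<mu> a - \<nu> a\<bar> \<le> ennreal (\<bar>\<mu> a - \<kappa> a\<bar> + \<bar>\<kappa> a - \<nu> a\<bar>)"
    by (rule ennreal_leI) simp
  also have "\<dots> = ennreal \<bar>\<mu> a - \<kappa> a\<bar> + ennreal \<bar>\<kappa> a - \<nu> a\<bar>" by simp
  also have "\<dots> \<le> (SUP a\<in>{a. L a \<le> 1}. ennreal \<bar>\<mu> a - \<kappa> a\<bar>) + (SUP a\<in>{a. L a \<le> 1}. ennreal \<bar>\<kappa> a - \<nu> a\<bar>)"
    using a by (intro add_mono SUP_upper)
  finally show "ennreal \<bar>\<mu> a - \<nu> a\<bar> \<le> \<dots>" .
qed

text \<open>Scale \<open>a\<close> into the unit ball of \<open>L\<close>. Since \<open>L a\<close>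
  may be zero, the scaling uses an arbitrary \<open>t\<close> above \<open>L a\<close>, which is
  then lowered to \<open>L a\<close>.\<close>

lemma rho_le_imp:
  assumes "seminorm L" "linear \<mu>" "linear \<nu>" "rho L \<mu> \<nu> \<le> ennreal \<epsilon>" "0 \<le> \<epsilon>"
  shows "\<bar>\<mu> a - \<nu> a\<bar> \<le> \<epsilon> * L a"
proof -
  have unit: "\<bar>\<mu> a - \<nu> a\<bar> \<le> \<epsilon>" if "L a \<le> 1" for a
  proof -
    have "ennreal \<bar>\<mu> a - \<nu> a\<bar> \<le> rho L \<mu> \<nu>"
      unfolding rho_def using that by (intro SUP_upper) simp
    then show ?thesis using assms(4,5) by (meson ennreal_le_iff order_trans)
  qed
  have t: "\<bar>\<mu> a - \<nu> a\<bar> \<le> \<epsilon> * t" if "L a < t" for t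
  proof -
    have t: "0 < t" using that seminormD(5)[OF assms(1), of a] by linarith
    have "L (inverse t *\<^sub>R a) \<le> 1"
      using t that by (simp add: seminormD(2)[OF assms(1)] field_simps)
    from unit[OF this] have "\<bar>inverse t * (\<mu> a - \<nu> a)\<bar> \<le> \<epsilon>"
      by (simp add: linear_scale[OF assms(2)] linear_scale[OF assms(3)] right_diff_distrib)
    then show ?thesis using t by (simp add: abs_mult field_simps)
  qed
  show ?thesis
  proof (rule field_le_epsilon)
    fix e :: real assume "0 < e"
    \<comment> \<open>The excess \<open>e / (\<epsilon> + 1)\<close> costs at most \<open>e\<close>
      after multiplication by \<open>\<epsilon>\<close> and is well defined also for
      \<open>\<epsilon> = 0\<close>.\<close>
    then have "\<bar>\<mu> a - \<nu> a\<bar> \<le> \<epsilon> * (L a + e / (\<epsilon> + 1))" using assms(5) by (intro t) simp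
    also have "\<epsilon> * (L a + e / (\<epsilon> + 1)) \<le> \<epsilon> * L a + e"
      using assms(5) \<open>0 < e\<close> by (simp add: field_simps)
    finally show "\<bar>\<mu> a - \<nu> a\<bar> \<le> \<epsilon> * L a + e" .
  qed
qed

text \<open>For a Lip-norm the balls of \<open>rho L\<close> are weak-* open, so compactness of the
  states leaves finitely many of them as a cover; the net consists of their centres.\<close>

lemma lip_norm_finite_net:
  fixes L :: "'a::order_unit_space \<Rightarrow> real"
  assumes L: "lip_norm L" and \<epsilon>: "0 < \<epsilon>"
  obtains F where "finite F" "F \<subseteq> states"
    "\<And>\<nu>. \<nu> \<in> states \<Longrightarrow> \<exists>\<mu>\<in>F. \<forall>a. \<bar>\<mu> a - \<nu> a\<bar> \<le> \<epsilon> * L a"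
proof -
  define B where "B \<mu> = {\<nu>\<in>states. rho L \<mu> \<nu> < ennreal \<epsilon>}" for \<mu>
  have "rho_open L (B \<mu>)" for \<mu>
    unfolding rho_open_def
  proof (intro conjI ballI)
    fix \<nu> assume "\<nu> \<in> B \<mu>"
    then have \<nu>: "rho L \<mu> \<nu> < ennreal \<epsilon>" by (simp add: B_def)
    define \<delta> where "\<delta> = ennreal \<epsilon> - rho L \<mu> \<nu>"
    have "0 < \<delta>" using \<nu> by (simp add: \<delta>_def diff_gt_0_iff_gt_ennreal)
    moreover have "\<kappa> \<in> B \<mu>" if \<kappa>: "\<kappa> \<in> states" "rho L \<nu> \<kappa> < \<delta>" for \<kappa>
    proof -
      have "rho L \<mu> \<kappa> \<le> rho L \<nu> \<kappa> + rho L \<mu> \<nu>"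
        using rho_triangle[of L \<mu> \<kappa> \<nu>] by (simp add: add.commute)
      also have "\<dots> < ennreal \<epsilon>"
        using \<kappa>(2) \<nu> by (subst less_diff_eq_ennreal[symmetric]) (auto simp: \<delta>_def)
      finally show ?thesis using \<kappa>(1) by (simp add: B_def)
    qed
    ultimately show "\<exists>\<delta>>0. \<forall>\<kappa>\<in>states. rho L \<nu> \<kappa> < \<delta> \<longrightarrow> \<kappa> \<in> B \<mu>" by blast
  qed (auto simp: B_def)
  then have "openin weak_star_states (B \<mu>)" for \<mu>
    using L by (metis lip_norm_def openin_rho_topology)
  moreover have "\<mu> \<in> B \<mu>" if "\<mu> \<in> states" for \<mu>
    using that \<epsilon> by (auto simp: B_def rho_def SUP_constant bot_ennreal)
  then have "states \<subseteq> \<Union>(B ` states)" by blast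
  ultimately obtain T where T: "finite T" "T \<subseteq> B ` states" "states \<subseteq> \<Union>T"
    using compactinD[OF compactin_states, of "B ` states"] by auto
  then obtain F where F: "F \<subseteq> states" "finite F" "T = B ` F"
    using finite_subset_image[OF T(1,2)] by blast
  have "\<exists>\<mu>\<in>F. \<forall>a. \<bar>\<mu> a - \<nu> a\<bar> \<le> \<epsilon> * L a" if \<nu>: "\<nu> \<in> states" for \<nu>
  proof -
    obtain \<mu> where \<mu>: "\<mu> \<in> F" "\<nu> \<in> B \<mu>" using T(3) F(3) \<nu> by auto
    then have "\<forall>a. \<bar>\<mu> a - \<nu> a\<bar> \<le> \<epsilon> * L a"
      using L F(1) \<nu> \<epsilon> by (intro allI rho_le_imp) (auto simp: lip_norm_def B_def statesD(1))
    with \<mu>(1) show ?thesis by blast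
  qed
  with F(1,2) show thesis by (intro that)
qed

subsection \<open>Limits in the completion\<close>

lemma completion_embed_zero: "completion_embed 0 = 0"
  using completion_embed_scaleR[of 0 0] by simp

lemma le_add_ou_norm:
  fixes x y :: "'a::order_unit_space"
  assumes "ou_norm (x - y) \<le> r"
  shows "x \<le> y + r *\<^sub>R order_unit"
  using order_trans[OF ou_norm_props(2)[of "x - y"] ou_scale_mono[OF assms]]
  by (simp add: algebra_simps)

definition approximates :: "'i filter \<Rightarrow> ('i \<Rightarrow> 'a::order_unit_space) \<Rightarrow> 'a completion \<Rightarrow> bool" where
  "approximates F a x \<longleftrightarrow> ((\<lambda>i. ou_norm (x - completion_embed (a i))) \<longlongrightarrow> 0) F"

lemma approximates_iff:
  "approximates F a x \<longleftrightarrow> (\<forall>\<epsilon>>0. \<forall>\<^sub>F i in F. ou_norm (x - completion_embed (a i)) < \<epsilon>)"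
  by (simp add: approximates_def tendsto_iff ou_norm_props(1))

lemma approximates_const: "approximates F (\<lambda>i. a) (completion_embed a)"
  by (simp add: approximates_def)

lemma approximates_add:
  assumes "approximates F a x" "approximates F b y"
  shows "approximates F (\<lambda>i. a i + b i) (x + y)"
  unfolding approximates_def
proof (rule tendsto_sandwich[OF _ _ tendsto_const])
  show "((\<lambda>i. ou_norm (x - completion_embed (a i)) + ou_norm (y - completion_embed (b i))) \<longlongrightarrow> 0) F"
    using tendsto_add[OF assms[unfolded approximates_def]] by simp
  show "\<forall>\<^sub>F i in F. ou_norm (x + y - completion_embed (a i + b i))
      \<le> ou_norm (x - completion_embed (a i)) + ou_norm (y - completion_embed (b i))"
    using ou_norm_triangle[of "x - completion_embed (a i)" "y - completion_embed (b i)" for i]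
    by (intro always_eventually allI) (simp add: completion_embed_add algebra_simps)
qed (auto simp: ou_norm_props(1))

lemma approximates_scaleR:
  assumes "approximates F a x"
  shows "approximates F (\<lambda>i. r *\<^sub>R a i) (r *\<^sub>R x)"
  unfolding approximates_def
proof (rule tendsto_sandwich[OF _ _ tendsto_const])
  show "((\<lambda>i. \<bar>r\<bar> * ou_norm (x - completion_embed (a i))) \<longlongrightarrow> 0) F"
    using tendsto_mult_left[OF assms[unfolded approximates_def], of "\<bar>r\<bar>"] by simp
  show "\<forall>\<^sub>F i in F. ou_norm (r *\<^sub>R x - completion_embed (r *\<^sub>R a i))
      \<le> \<bar>r\<bar> * ou_norm (x - completion_embed (a i))"
    using ou_norm_scaleR_le[of r "x - completion_embed (a i)" for i]
    by (intro always_eventually allI) (simp add: completion_embed_scaleR scaleR_diff_right)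
qed (auto simp: ou_norm_props(1))

text \<open>Along an ultrafilter each state of a finite net converges on the given elements, and
  on a Lipschitz-bounded set the net controls all states uniformly.\<close>

lemma ultrafilter_lip_bounded_converges:
  fixes b :: "'i \<Rightarrow> 'b::order_unit_space"
  assumes U: "U \<noteq> bot" "\<And>P. eventually P U \<or> eventually (\<lambda>i. \<not> P i) U"
    and L: "lip_norm L" and Lb: "\<And>i. L (b i) \<le> t" and bound: "\<And>i. ou_norm (b i) \<le> M"
  shows "\<exists>y. approximates U b y"
proof -
  have semi: "seminorm L" using L by (simp add: lip_norm_def)
  have t: "0 \<le> t" using seminormD(5)[OF semi] Lb order_trans by blast
  have close: "\<exists>c. \<forall>\<^sub>F i in U. ou_norm (b i - c) < \<epsilon>" if \<epsilon>: "0 < \<epsilon>" for \<epsilon>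
  proof -
    \<comment> \<open>Chosen so that \<open>2 * (\<delta> * t) + 2 * \<delta> < \<epsilon>\<close>,
      the total error below; \<open>t + 1\<close> also covers \<open>t = 0\<close>.\<close>
    define \<delta> where "\<delta> = \<epsilon> / (4 * (t + 1))"
    have "\<delta> * (t + 1) = \<epsilon> / 4" using t by (simp add: \<delta>_def add_nonneg_eq_0_iff divide_simps)
    then have "\<delta> * t + \<delta> < \<epsilon> / 2" using \<epsilon> by (simp add: algebra_simps)
    then have \<delta>: "0 < \<delta>" "2 * (\<delta> * t) + 2 * \<delta> < \<epsilon>"
      using t \<epsilon> by (simp add: \<delta>_def, linarith)
    obtain F where F: "finite F" "F \<subseteq> states"
      "\<And>\<nu>. \<nu> \<in> states \<Longrightarrow> \<exists>\<mu>\<in>F. \<forall>a. \<bar>\<mu> a - \<nu> a\<bar> \<le> \<delta> * L a"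
      using lip_norm_finite_net[OF L \<delta>(1)] by blast
    have "\<exists>l. ((\<lambda>i. \<mu> (b i)) \<longlongrightarrow> l) U" if "\<mu> \<in> F" for \<mu>
    proof (rule ultrafilter_limit_compact[OF U])
      have "\<bar>\<mu> (b i)\<bar> \<le> M" for i
        using that F(2) statesD(3)[of \<mu> "b i"] bound[of i] by auto
      then show "\<mu> (b i) \<in> {-M..M}" for i by (simp add: abs_le_iff minus_le_iff)
    qed simp
    then obtain l where l: "\<And>\<mu>. \<mu> \<in> F \<Longrightarrow> ((\<lambda>i. \<mu> (b i)) \<longlongrightarrow> l \<mu>) U" by metis
    have ev: "\<forall>\<^sub>F i in U. \<forall>\<mu>\<in>F. \<bar>\<mu> (b i) - l \<mu>\<bar> < \<delta>"
      using F(1) tendstoD[OF l \<delta>(1)] by (intro eventually_ball_finite) (auto simp: dist_real_def)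
    \<comment> \<open>Any member of the family whose values on the net are near their limits serves
      as the centre \<open>c\<close>.\<close>
    then obtain j where j: "\<forall>\<mu>\<in>F. \<bar>\<mu> (b j) - l \<mu>\<bar> < \<delta>"
      using eventually_happens'[OF U(1)] by blast
    have "\<forall>\<^sub>F i in U. ou_norm (b i - b j) < \<epsilon>"
      using ev
    proof eventually_elim
      case (elim i)
      \<comment> \<open>For each of \<open>b i\<close> and \<open>b j\<close>, passing from
        \<open>\<nu>\<close> to its net point \<open>\<mu>\<close> costs
        \<open>\<delta> * t\<close>, and passing on to \<open>l \<mu>\<close> costs
        \<open>\<delta>\<close>.\<close>
      have "ou_norm (b i - b j) \<le> 2 * (\<delta> * t) + 2 * \<delta>"
      proof (rule ou_norm_le_if_states_le)
        show "0 \<le> 2 * (\<delta> * t) + 2 * \<delta>" using t \<delta>(1) by simp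
        fix \<nu> :: "'b \<Rightarrow> real" assume \<nu>: "\<nu> \<in> states"
        then obtain \<mu> where \<mu>: "\<mu> \<in> F" "\<And>a. \<bar>\<mu> a - \<nu> a\<bar> \<le> \<delta> * L a" using F(3) by blast
        have "\<bar>\<mu> (b k) - \<nu> (b k)\<bar> \<le> \<delta> * t" for k
          using order_trans[OF \<mu>(2)[of "b k"] mult_left_mono[OF Lb[of k]]] \<delta>(1) by simp
        from this[of i] this[of j] show "\<bar>\<nu> (b i - b j)\<bar> \<le> 2 * (\<delta> * t) + 2 * \<delta>"
          using elim j \<mu>(1) unfolding linear_diff[OF statesD(1)[OF \<nu>]] by (smt (verit))
      qed
      with \<delta>(2) show ?case by simp
    qed
    then show ?thesis by blast
  qed
  then have "\<exists>c. \<forall>\<^sub>F i in U. ou_norm (b i - c) < inverse (real (Suc k))" for k by simp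
  then obtain c where c: "\<And>k. \<forall>\<^sub>F i in U. ou_norm (b i - c k) < inverse (real (Suc k))" by metis
  have small: "\<exists>N. \<forall>k\<ge>N. inverse (real (Suc k)) < \<epsilon>" if "0 < \<epsilon>" for \<epsilon>
    using order_tendstoD(2)[OF LIMSEQ_inverse_real_of_nat that] by (simp add: eventually_sequentially)
  have "ou_Cauchy c"
    unfolding ou_Cauchy_def
  proof (intro allI impI)
    fix \<epsilon> :: real assume "0 < \<epsilon>"
    then obtain N where N: "\<And>k. k \<ge> N \<Longrightarrow> inverse (real (Suc k)) < \<epsilon> / 2" using small[of "\<epsilon> / 2"] by auto
    have "ou_norm (c k - c m) < \<epsilon>" if "k \<ge> N" "m \<ge> N" for k m
    proof -
      \<comment> \<open>Both closeness conditions hold along the proper filter \<open>U\<close>, so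
        a common index compares \<open>c k\<close> with \<open>c m\<close>.\<close>
      obtain i where "ou_norm (b i - c k) < inverse (real (Suc k))" "ou_norm (b i - c m) < inverse (real (Suc m))"
        using eventually_happens'[OF U(1) eventually_conj[OF c[of k] c[of m]]] by blast
      then show ?thesis
        using N[OF that(1)] N[OF that(2)] ou_norm_diff_triangle[of "c k" "c m" "b i"]
          ou_norm_diff_commute[of "c k" "b i"] by linarith
    qed
    then show "\<exists>N. \<forall>m\<ge>N. \<forall>n\<ge>N. ou_norm (c m - c n) < \<epsilon>" by blast
  qed
  note lim = completion_limit[OF this]
  let ?y = "abs_completion c"
  have "approximates U b ?y"
    unfolding approximates_iff
  proof (intro allI impI)
    fix \<epsilon> :: real assume "0 < \<epsilon>"
    then have \<epsilon>: "0 < \<epsilon> / 2" by simp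
    obtain N where N: "inverse (real (Suc k)) < \<epsilon> / 2" if "k \<ge> N" for k using small[OF \<epsilon>] by blast
    obtain N' where N': "ou_norm (?y - completion_embed (c k)) < \<epsilon> / 2" if "k \<ge> N'" for k
      using order_tendstoD(2)[OF lim \<epsilon>] by (auto simp: eventually_sequentially)
    let ?k = "max N N'"
    show "\<forall>\<^sub>F i in U. ou_norm (?y - completion_embed (b i)) < \<epsilon>"
      using c[of ?k]
    proof eventually_elim
      case (elim i)
      have "ou_norm (completion_embed (c ?k) - completion_embed (b i)) = ou_norm (b i - c ?k)"
        by (simp add: ou_norm_embed ou_norm_diff_commute flip: completion_embed_diff)
      then show ?case
        using elim N[of ?k] N'[of ?k]
          ou_norm_diff_triangle[of ?y "completion_embed (b i)" "completion_embed (c ?k)"] by simp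
    qed
  qed
  then show ?thesis ..
qed

text \<open>The strict bound is free, since an approximant can be shrunk slightly. It is the form
  that lifts through a bridge, where an infimum yields elements strictly below \<open>t\<close> and
  none at \<open>t\<close> itself, so that the radius is kept exactly.\<close>

lemma scaled_lip_ball_iff:
  fixes L :: "'a::order_unit_space \<Rightarrow> real"
  assumes L: "seminorm L" and t: "0 < t"
  shows "x \<in> (*\<^sub>R) t ` closed_lip_ball L \<longleftrightarrow>
    (\<forall>\<epsilon>>0. \<exists>a. L a < t \<and> ou_norm (x - completion_embed a) < \<epsilon>)"
proof safe
  fix z and \<epsilon> :: real assume z: "z \<in> closed_lip_ball L" and \<epsilon>: "0 < \<epsilon>"
  obtain a where a: "L a \<le> 1" "ou_norm (z - completion_embed a) < \<epsilon> / (2 * t)"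
    using z \<epsilon> t unfolding closed_lip_ball_def by (auto dest!: spec[of _ "\<epsilon> / (2 * t)"])
  define w where "w = t * ou_norm a"
  \<comment> \<open>The bound \<open>1 / 2\<close> keeps the factor \<open>1 - \<eta>\<close>
    positive; the other bound makes the norm \<open>\<eta> * w\<close> lost by shrinking less than
    \<open>\<epsilon> / 2\<close>.\<close>
  define \<eta> where "\<eta> = min (1 / 2) (\<epsilon> / (4 * (w + 1)))"
  have w: "0 \<le> w" using t ou_norm_props(1)[of a] by (simp add: w_def)
  have \<eta>: "0 < \<eta>" "\<eta> \<le> 1 / 2" "\<eta> \<le> \<epsilon> / (4 * (w + 1))"
    using w \<epsilon> unfolding \<eta>_def by (simp, intro min.cobounded1, intro min.cobounded2)
  then have "\<eta> * (w + 1) \<le> \<epsilon> / 4" using w by (simp add: field_simps)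
  then have \<eta>w: "\<eta> * w < \<epsilon> / 2" using \<eta>(1) \<epsilon> by (simp add: algebra_simps)
  let ?a = "((1 - \<eta>) * t) *\<^sub>R a"
  have "L ?a = (1 - \<eta>) * t * L a" using \<eta> t by (simp add: seminormD(2)[OF L])
  also have "\<dots> \<le> (1 - \<eta>) * t" using a(1) \<eta> t by (simp add: mult_left_le)
  also have "\<dots> < t" using \<eta>(1) t by simp
  finally have "L ?a < t" .
  moreover have "ou_norm (t *\<^sub>R z - completion_embed ?a) < \<epsilon>"
  proof -
    have "t *\<^sub>R z - completion_embed ?a = t *\<^sub>R (z - completion_embed a) + completion_embed ((\<eta> * t) *\<^sub>R a)"
      by (simp only: completion_embed_scaleR) (simp add: algebra_simps)
    then have "ou_norm (t *\<^sub>R z - completion_embed ?a) \<le> t * ou_norm (z - completion_embed a) + \<eta> * w"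
      using ou_norm_triangle[of "t *\<^sub>R (z - completion_embed a)" "completion_embed ((\<eta> * t) *\<^sub>R a)"]
        ou_norm_scaleR_le[of t "z - completion_embed a"] ou_norm_scaleR_le[of "\<eta> * t" a] t \<eta>(1)
      by (simp add: ou_norm_embed w_def abs_mult mult.assoc)
    also have "t * ou_norm (z - completion_embed a) < \<epsilon> / 2" using a(2) t by (simp add: field_simps)
    finally show ?thesis using \<eta>w by simp
  qed
  ultimately show "\<exists>a. L a < t \<and> ou_norm (t *\<^sub>R z - completion_embed a) < \<epsilon>" by blast
next
  assume *: "\<forall>\<epsilon>>0. \<exists>a. L a < t \<and> ou_norm (x - completion_embed a) < \<epsilon>"
  have "inverse t *\<^sub>R x \<in> closed_lip_ball L"
    unfolding closed_lip_ball_def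
  proof (intro CollectI allI impI)
    fix \<epsilon> :: real assume "0 < \<epsilon>"
    then obtain a where a: "L a < t" "ou_norm (x - completion_embed a) < t * \<epsilon>"
      using * t by (metis mult_pos_pos)
    have "L (inverse t *\<^sub>R a) \<le> 1" using a(1) t by (simp add: seminormD(2)[OF L] field_simps)
    moreover have "inverse t * ou_norm (x - completion_embed a) < \<epsilon>" using a(2) t by (simp add: field_simps)
    then have "ou_norm (inverse t *\<^sub>R x - completion_embed (inverse t *\<^sub>R a)) < \<epsilon>"
      using ou_norm_scaleR_le[of "inverse t" "x - completion_embed a"] t
      by (simp add: completion_embed_scaleR scaleR_diff_right)
    ultimately show "\<exists>a. L a \<le> 1 \<and> ou_norm (inverse t *\<^sub>R x - completion_embed a) < \<epsilon>" by blast
  qed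
  then show "x \<in> (*\<^sub>R) t ` closed_lip_ball L" using t by (intro image_eqI) auto
qed

subsection \<open>Bridges\<close>

text \<open>The consequences of an inducing Lip-norm at small Hausdorff distance that enter the
  limit argument. Each infimum is split into a lower bound and an approximation from above, and all
  conditions are symmetric in the two summands.\<close>

definition bridge ::
  "real \<Rightarrow> ('a::order_unit_space \<Rightarrow> real) \<Rightarrow> ('b::order_unit_space \<Rightarrow> real) \<Rightarrow> ('a \<times> 'b \<Rightarrow> real) \<Rightarrow> bool" where
  "bridge \<epsilon> LA LB L \<longleftrightarrow> seminorm L \<and> L order_unit = 0 \<and>
     (\<forall>a b. LA a \<le> L (a, b)) \<and> (\<forall>a b. LB b \<le> L (a, b)) \<and>
     (\<forall>a t. LA a < t \<longrightarrow> (\<exists>b. L (a, b) < t)) \<and> (\<forall>b t. LB b < t \<longrightarrow> (\<exists>a. L (a, b) < t)) \<and>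
     (\<forall>\<mu>\<in>states. \<exists>\<nu>\<in>states. \<forall>a b. \<bar>\<mu> a - \<nu> b\<bar> \<le> \<epsilon> * L (a, b)) \<and>
     (\<forall>\<nu>\<in>states. \<exists>\<mu>\<in>states. \<forall>a b. \<bar>\<mu> a - \<nu> b\<bar> \<le> \<epsilon> * L (a, b))"

lemma bridge_swap:
  assumes "bridge \<epsilon> LA LB L" shows "bridge \<epsilon> LB LA (L \<circ> prod.swap)"
proof -
  have L: "seminorm L" using assms by (simp add: bridge_def)
  have "prod.swap (x + y) = prod.swap x + prod.swap y" "prod.swap (r *\<^sub>R x) = r *\<^sub>R prod.swap x"
    for x y :: "'b \<times> 'a" and r by (simp_all add: prod_eq_iff)
  then have "seminorm (L \<circ> prod.swap)"
    unfolding seminorm_def by (simp add: seminormD(1,2)[OF L] del: split_paired_All)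
  then show ?thesis
    using assms unfolding bridge_def order_unit_prod_def
    by simp (intro conjI; metis abs_minus_commute)
qed

text \<open>An empty infimum is infinite, so the strict bound supplies an actual \<open>L\<close>.
  Strictness of its Hausdorff distance gives each state a partner closer than
  \<open>\<epsilon>\<close>, and \<open>rho_le_imp\<close> turns this into the pointwise
  estimate.\<close>

lemma dist_q_less_imp_bridge:
  fixes LA :: "'a::order_unit_space \<Rightarrow> real" and LB :: "'b::order_unit_space \<Rightarrow> real"
  assumes "dist_q LA LB < ennreal \<epsilon>" "0 < \<epsilon>"
  shows "\<exists>L. bridge \<epsilon> LA LB L"
proof -
  obtain L where L: "L \<in> inducing_lip_norms LA LB"
    and H: "hausdorff_dist (rho L) ((\<lambda>\<mu>. \<mu> \<circ> fst) ` states) ((\<lambda>\<nu>. \<nu> \<circ> snd) ` states) < ennreal \<epsilon>"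
    using assms(1) unfolding dist_q_def by (auto simp: INF_less_iff)
  have lip: "lip_norm L" and LA: "\<And>a. LA a = (INF b. L (a, b))" and LB: "\<And>b. LB b = (INF a. L (a, b))"
    using L by (auto simp: inducing_lip_norms_def)
  then have semi: "seminorm L" and unit: "L order_unit = 0"
    by (auto simp: lip_norm_def simp del: split_paired_All intro: range_eqI[of _ _ 1])
  have bdd: "bdd_below (range (\<lambda>b. L (a, b)))" "bdd_below (range (\<lambda>a. L (a, b)))" for a b
    using seminormD(5)[OF semi] by (auto intro!: bdd_belowI2)
  have close: "\<bar>\<mu> a - \<nu> b\<bar> \<le> \<epsilon> * L (a, b)"
    if "\<mu> \<in> states" "\<nu> \<in> states" "rho L (\<mu> \<circ> fst) (\<nu> \<circ> snd) < ennreal \<epsilon>" for \<mu> \<nu> a b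
    using rho_le_imp[OF semi, of "\<mu> \<circ> fst" "\<nu> \<circ> snd" \<epsilon> "(a, b)"] that assms(2)
    by (simp add: linear_compose linear_fst linear_snd statesD(1))
  have fwd: "\<exists>\<nu>\<in>states. rho L (\<mu> \<circ> fst) (\<nu> \<circ> snd) < ennreal \<epsilon>" if "\<mu> \<in> states" for \<mu>
  proof -
    have "(INF y\<in>(\<lambda>\<nu>. \<nu> \<circ> snd) ` states. rho L (\<mu> \<circ> fst) y) < ennreal \<epsilon>"
      using that
      by (intro le_less_trans[OF _ H[unfolded hausdorff_dist_def]] max.coboundedI1 SUP_upper imageI)
    then show ?thesis by (auto simp: INF_less_iff)
  qed
  have bwd: "\<exists>\<mu>\<in>states. rho L (\<mu> \<circ> fst) (\<nu> \<circ> snd) < ennreal \<epsilon>" if "\<nu> \<in> states" for \<nu>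
  proof -
    have "(INF x\<in>(\<lambda>\<mu>. \<mu> \<circ> fst) ` states. rho L x (\<nu> \<circ> snd)) < ennreal \<epsilon>"
      using that
      by (intro le_less_trans[OF _ H[unfolded hausdorff_dist_def]] max.coboundedI2 SUP_upper imageI)
    then show ?thesis by (auto simp: INF_less_iff)
  qed
  have le: "LA a \<le> L (a, b)" "LB b \<le> L (a, b)" for a b
    unfolding LA LB by (auto intro: cINF_lower[OF bdd(1)] cINF_lower[OF bdd(2)])
  have exb: "\<exists>b. L (a, b) < t" if "LA a < t" for a t
    using that unfolding LA by (subst (asm) cINF_less_iff) (auto intro: bdd)
  have exa: "\<exists>a. L (a, b) < t" if "LB b < t" for b t
    using that unfolding LB by (subst (asm) cINF_less_iff) (auto intro: bdd)
  have "bridge \<epsilon> LA LB L"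
    unfolding bridge_def
  proof (intro conjI allI ballI impI)
    show "\<exists>\<nu>\<in>states. \<forall>a b. \<bar>\<mu> a - \<nu> b\<bar> \<le> \<epsilon> * L (a, b)" if "\<mu> \<in> states" for \<mu>
      using fwd[OF that] close[OF that] by meson
    show "\<exists>\<mu>\<in>states. \<forall>a b. \<bar>\<mu> a - \<nu> b\<bar> \<le> \<epsilon> * L (a, b)" if "\<nu> \<in> states" for \<nu>
      using bwd[OF that] close[OF _ that] by meson
  qed (use semi unit le exa exb in simp_all)
  then show ?thesis by blast
qed

section \<open>Limits of bridges along an ultrafilter and the graph of the isometry\<close>

definition limit_graph ::
  "nat filter \<Rightarrow> (nat \<Rightarrow> 'a::order_unit_space \<times> 'b::order_unit_space \<Rightarrow> real) \<Rightarrow>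
    'a completion \<Rightarrow> 'b completion \<Rightarrow> bool" where
  "limit_graph U L x y \<longleftrightarrow>
     (\<exists>t a b. (\<forall>n. L n (a n, b n) \<le> t) \<and> approximates U a x \<and> approximates U b y)"

lemma limit_graph_swap: "limit_graph U (\<lambda>n. L n \<circ> prod.swap) y x \<longleftrightarrow> limit_graph U L x y"
  by (auto simp: limit_graph_def)

locale bridge_sequence =
  fixes U :: "nat filter" and LA :: "'a::order_unit_space \<Rightarrow> real" and LB :: "'b::order_unit_space \<Rightarrow> real"
    and L :: "nat \<Rightarrow> 'a \<times> 'b \<Rightarrow> real"
  assumes U: "U \<le> sequentially" "U \<noteq> bot" "\<And>P. eventually P U \<or> eventually (\<lambda>n. \<not> P n) U"
    and lip: "lip_norm LA" "lip_norm LB"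
    and bridge: "\<And>n. bridge (inverse (real (Suc n))) LA LB (L n)"
begin

text \<open>Every result on the graph thereby holds for the converse relation as well, which later
  gives injectivity, surjectivity and the reverse order implication.\<close>

lemma swap: "bridge_sequence U LB LA (\<lambda>n. L n \<circ> prod.swap)"
  using U lip bridge_swap[OF bridge] by unfold_locales auto

lemma seminorm_bridge: "seminorm (L n)"
  using bridge[of n] by (simp add: bridge_def)

lemma graph_add:
  assumes "limit_graph U L x y" "limit_graph U L x' y'"
  shows "limit_graph U L (x + x') (y + y')"
proof -
  obtain t a b t' a' b' where "\<And>n. L n (a n, b n) \<le> t" "\<And>n. L n (a' n, b' n) \<le> t'"
    and "approximates U a x" "approximates U b y" "approximates U a' x'" "approximates U b' y'"
    using assms unfolding limit_graph_def by blast
  moreover from this have "L n (a n + a' n, b n + b' n) \<le> t + t'" for n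
    using seminormD(1)[OF seminorm_bridge, of n "(a n, b n)" "(a' n, b' n)"]
    by (simp add: order_trans[OF _ add_mono])
  ultimately show ?thesis unfolding limit_graph_def
    by (intro exI[of _ "t + t'"] exI[of _ "\<lambda>n. a n + a' n"] exI[of _ "\<lambda>n. b n + b' n"])
      (simp add: approximates_add)
qed

lemma graph_scaleR:
  assumes "limit_graph U L x y" shows "limit_graph U L (r *\<^sub>R x) (r *\<^sub>R y)"
proof -
  obtain t a b where "\<And>n. L n (a n, b n) \<le> t" and "approximates U a x" "approximates U b y"
    using assms unfolding limit_graph_def by blast
  moreover from this have "L n (r *\<^sub>R a n, r *\<^sub>R b n) \<le> \<bar>r\<bar> * t" for n
    using seminormD(2)[OF seminorm_bridge, of n r "(a n, b n)"] by (simp add: mult_left_mono)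
  ultimately show ?thesis unfolding limit_graph_def
    by (intro exI[of _ "\<bar>r\<bar> * t"] exI[of _ "\<lambda>n. r *\<^sub>R a n"] exI[of _ "\<lambda>n. r *\<^sub>R b n"])
      (simp add: approximates_scaleR)
qed

lemma graph_diff:
  assumes "limit_graph U L x y" "limit_graph U L x' y'"
  shows "limit_graph U L (x - x') (y - y')"
  using graph_add[OF assms(1) graph_scaleR[OF assms(2), of "-1"]] by simp

lemma graph_order_unit: "limit_graph U L order_unit order_unit"
  unfolding limit_graph_def
proof (intro exI conjI allI)
  show "L n (order_unit, order_unit) \<le> 0" for n
    using bridge[of n] by (simp add: bridge_def flip: order_unit_prod_def)
qed (auto simp: approximates_const simp flip: completion_embed_order_unit)

text \<open>One constant \<open>t\<close> bounds all \<open>L n (a n, b n)\<close>, so paired states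
  differ on \<open>a n\<close> and \<open>b n\<close> by at most \<open>t / (n + 1)\<close>.
  Positivity of \<open>x\<close> therefore passes through \<open>a n\<close> and \<open>b n\<close>
  to \<open>y\<close> with an arbitrarily small loss.\<close>

lemma graph_nonneg:
  assumes G: "limit_graph U L x y" and x: "0 \<le> x"
  shows "0 \<le> y"
proof -
  obtain t a b where t: "\<And>n. L n (a n, b n) \<le> t"
    and a: "approximates U a x" and b: "approximates U b y"
    using G unfolding limit_graph_def by blast
  have "- y \<le> r *\<^sub>R order_unit" if r: "0 < r" for r
  proof -
    \<comment> \<open>One third for each passage: from \<open>x\<close> to \<open>a n\<close>, from
      \<open>a n\<close> to \<open>b n\<close>, and from \<open>b n\<close> to
      \<open>y\<close>.\<close>
    define \<delta> where "\<delta> = r / 3"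
    have \<delta>: "0 < \<delta>" using r by (simp add: \<delta>_def)
    have "(\<lambda>n. inverse (real (Suc n)) * t) \<longlonglongrightarrow> 0"
      using tendsto_mult_right[OF LIMSEQ_inverse_real_of_nat, of t] by simp
    from order_tendstoD(2)[OF this \<delta>] have "\<forall>\<^sub>F n in U. inverse (real (Suc n)) * t < \<delta>"
      by (rule filter_leD[OF U(1)])
    moreover have "\<forall>\<^sub>F n in U. ou_norm (x - completion_embed (a n)) < \<delta>"
      "\<forall>\<^sub>F n in U. ou_norm (y - completion_embed (b n)) < \<delta>"
      using a b \<delta> by (auto simp: approximates_iff)
    ultimately have "\<forall>\<^sub>F n in U. inverse (real (Suc n)) * t < \<delta> \<and>
        ou_norm (x - completion_embed (a n)) < \<delta> \<and> ou_norm (y - completion_embed (b n)) < \<delta>"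
      by (intro eventually_conj)
    then obtain n where n: "inverse (real (Suc n)) * t < \<delta>" "ou_norm (x - completion_embed (a n)) < \<delta>"
      "ou_norm (y - completion_embed (b n)) < \<delta>"
      using eventually_happens'[OF U(2)] by blast
    have "0 \<le> completion_embed (a n) + \<delta> *\<^sub>R order_unit"
      using order_trans[OF x le_add_ou_norm] n(2) by simp
    also have "\<dots> = completion_embed (a n + \<delta> *\<^sub>R order_unit)"
      by (simp add: completion_embed_add completion_embed_scaleR completion_embed_order_unit)
    finally have an: "0 \<le> a n + \<delta> *\<^sub>R order_unit"
      by (simp add: completion_embed_le_iff flip: completion_embed_zero)
    have "0 \<le> b n + (2 * \<delta>) *\<^sub>R order_unit"
    proof (rule nonneg_if_states_nonneg)
      fix \<nu> :: "'b \<Rightarrow> real" assume \<nu>: "\<nu> \<in> states"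
      then obtain \<mu> where \<mu>: "\<mu> \<in> states" "\<bar>\<mu> (a n) - \<nu> (b n)\<bar> \<le> inverse (real (Suc n)) * L n (a n, b n)"
        using bridge[of n] unfolding bridge_def by blast
      have "inverse (real (Suc n)) * L n (a n, b n) \<le> inverse (real (Suc n)) * t"
        using t by (intro mult_left_mono) auto
      then have "\<bar>\<mu> (a n) - \<nu> (b n)\<bar> < \<delta>" using \<mu>(2) n(1) by linarith
      moreover have "0 \<le> \<mu> (a n) + \<delta>"
        using states_nonneg[OF \<mu>(1) an] statesD(2)[OF \<mu>(1)]
        by (simp add: linear_add[OF statesD(1)[OF \<mu>(1)]] linear_scale[OF statesD(1)[OF \<mu>(1)]])
      ultimately show "0 \<le> \<nu> (b n + (2 * \<delta>) *\<^sub>R order_unit)"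
        using statesD(2)[OF \<nu>]
        by (simp add: linear_add[OF statesD(1)[OF \<nu>]] linear_scale[OF statesD(1)[OF \<nu>]])
    qed
    then have "0 \<le> completion_embed (b n + (2 * \<delta>) *\<^sub>R order_unit)"
      by (simp add: completion_embed_le_iff flip: completion_embed_zero)
    then have bn: "0 \<le> completion_embed (b n) + (2 * \<delta>) *\<^sub>R order_unit"
      by (simp add: completion_embed_add completion_embed_scaleR completion_embed_order_unit)
    have "completion_embed (b n) \<le> y + \<delta> *\<^sub>R order_unit"
      using n(3) by (intro le_add_ou_norm) (simp add: ou_norm_diff_commute)
    from order_trans[OF bn add_right_mono[OF this]]
    have "0 \<le> y + (\<delta> *\<^sub>R order_unit + (2 * \<delta>) *\<^sub>R order_unit)" by (simp add: add.assoc)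
    also have "\<dots> = y + r *\<^sub>R order_unit" by (simp add: \<delta>_def flip: scaleR_add_left)
    finally have "0 - y \<le> r *\<^sub>R order_unit" by (simp only: diff_le_eq add.commute)
    then show ?thesis by simp
  qed
  then have "- y \<le> 0" by (rule order_unit_archimedean)
  then show ?thesis by simp
qed

text \<open>Approximants of \<open>x\<close> strictly inside the ball of radius \<open>t\<close>
  lift through the bridges to elements \<open>b n\<close> strictly inside the other ball. These are
  bounded in norm, so they converge along \<open>U\<close>.\<close>

lemma graph_extend:
  assumes t: "0 < t" and x: "x \<in> (*\<^sub>R) t ` closed_lip_ball LA"
  shows "\<exists>y\<in>(*\<^sub>R) t ` closed_lip_ball LB. limit_graph U L x y"
proof -
  have semi: "seminorm LA" "seminorm LB" using lip by (auto simp: lip_norm_def)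
  have "\<exists>a. LA a < t \<and> ou_norm (x - completion_embed a) < inverse (real (Suc n))" for n
    using x unfolding scaled_lip_ball_iff[OF semi(1) t] by simp
  then obtain a where a: "\<And>n. LA (a n) < t" "\<And>n. ou_norm (x - completion_embed (a n)) < inverse (real (Suc n))"
    by metis
  have "(\<lambda>n. ou_norm (x - completion_embed (a n))) \<longlonglongrightarrow> 0"
    by (rule ou_null_le[OF LIMSEQ_inverse_real_of_nat]) (rule less_imp_le[OF a(2)])
  then have ax: "approximates U a x" unfolding approximates_def by (rule tendsto_mono[OF U(1)])
  have "\<exists>b. L n (a n, b) < t" for n using bridge[of n] a(1)[of n] unfolding bridge_def by blast
  then obtain b where b: "\<And>n. L n (a n, b n) < t" by metis
  have Lb: "LB (b n) < t" for n
    using bridge[of n] b[of n] unfolding bridge_def by (meson le_less_trans)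
  have inv: "inverse (real (Suc n)) \<le> 1" for n by (simp add: field_simps)
  \<comment> \<open>The approximant \<open>a n\<close> is within 1 of \<open>x\<close>, and a state
    of \<open>b n\<close> differs from its partner on \<open>a n\<close> by at most
    \<open>t\<close>.\<close>
  have "ou_norm (b n) \<le> ou_norm x + 1 + t" for n
  proof (rule ou_norm_le_if_states_le)
    show "0 \<le> ou_norm x + 1 + t" using ou_norm_props(1)[of x] t by simp
    have "ou_norm (completion_embed (a n)) \<le> ou_norm x + ou_norm (x - completion_embed (a n))"
      using ou_norm_triangle[of x "completion_embed (a n) - x"]
      by (simp add: ou_norm_diff_commute[of x])
    then have an: "ou_norm (a n) \<le> ou_norm x + 1" using a(2)[of n] inv[of n] by (simp add: ou_norm_embed)
    fix \<nu> :: "'b \<Rightarrow> real" assume \<nu>: "\<nu> \<in> states"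
    then obtain \<mu> where \<mu>: "\<mu> \<in> states" "\<bar>\<mu> (a n) - \<nu> (b n)\<bar> \<le> inverse (real (Suc n)) * L n (a n, b n)"
      using bridge[of n] unfolding bridge_def by blast
    have "inverse (real (Suc n)) * L n (a n, b n) \<le> 1 * t"
      using b[of n] inv[of n] seminormD(5)[OF seminorm_bridge] by (intro mult_mono) auto
    then show "\<bar>\<nu> (b n)\<bar> \<le> ou_norm x + 1 + t"
      using \<mu>(2) an statesD(3)[OF \<mu>(1), of "a n"] by linarith
  qed
  then obtain y where y: "approximates U b y"
    using ultrafilter_lip_bounded_converges[where b = b, OF U(2,3) lip(2) less_imp_le[OF Lb]] by blast
  have "y \<in> (*\<^sub>R) t ` closed_lip_ball LB"
    unfolding scaled_lip_ball_iff[OF semi(2) t]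
  proof (intro allI impI)
    fix \<epsilon> :: real assume "0 < \<epsilon>"
    then obtain n where "ou_norm (y - completion_embed (b n)) < \<epsilon>"
      using y eventually_happens'[OF U(2)] unfolding approximates_iff by blast
    with Lb show "\<exists>b. LB b < t \<and> ou_norm (y - completion_embed b) < \<epsilon>" by blast
  qed
  moreover have "limit_graph U L x y"
    unfolding limit_graph_def using less_imp_le[OF b] ax y by blast
  ultimately show ?thesis by blast
qed

lemma graph_le:
  assumes "limit_graph U L x y" "limit_graph U L x' y'" "x \<le> x'"
  shows "y \<le> y'"
  using graph_nonneg[OF graph_diff[OF assms(2,1)]] assms(3) by simp

text \<open>Order preservation applied to \<open>x \<le> x\<close> in both directions, followed by
  antisymmetry.\<close>

lemma graph_fun:
  assumes "limit_graph U L x y" "limit_graph U L x y'"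
  shows "y = y'"
  using graph_le[OF assms] graph_le[OF assms(2,1)] by simp

text \<open>Some partner of \<open>x\<close> lies in the ball by \<open>graph_extend\<close>, and
  partners are unique.\<close>

lemma graph_ball:
  assumes "0 < t" "limit_graph U L x y" "x \<in> (*\<^sub>R) t ` closed_lip_ball LA"
  shows "y \<in> (*\<^sub>R) t ` closed_lip_ball LB"
  using graph_extend[OF assms(1,3)] graph_fun[OF assms(2)] by blast

lemma graph_closure_space:
  assumes "x \<in> closure_space LA"
  shows "\<exists>y\<in>closure_space LB. limit_graph U L x y"
proof -
  obtain t where t: "0 < t" "x \<in> (*\<^sub>R) t ` closed_lip_ball LA"
    using assms by (auto simp: closure_space_def)
  then obtain y where "y \<in> (*\<^sub>R) t ` closed_lip_ball LB" "limit_graph U L x y"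
    using graph_extend by blast
  with t(1) show ?thesis by (auto simp: closure_space_def)
qed

lemma isometry_exists: "\<exists>\<phi>. isometry LA LB \<phi>"
proof -
  interpret S: bridge_sequence U LB LA "\<lambda>n. L n \<circ> prod.swap" by (rule swap)
  note swap_iff = limit_graph_swap[of U L]
  \<comment> \<open>Single-valuedness of the converse graph.\<close>
  have inj: "x = x'" if "limit_graph U L x y" "limit_graph U L x' y" for x x' y
    using S.graph_fun[unfolded swap_iff] that by blast
  define \<phi> where "\<phi> x = (THE y. limit_graph U L x y)" for x
  have eq: "\<phi> x = y" if "limit_graph U L x y" for x y
    unfolding \<phi>_def using that graph_fun by blast
  have G: "limit_graph U L x (\<phi> x)" and mem: "\<phi> x \<in> closure_space LB" if x: "x \<in> closure_space LA" for x
    using graph_closure_space[OF x] eq by auto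
  have "isometry LA LB \<phi>"
    unfolding isometry_def
  proof (intro conjI ballI allI)
    have "y \<in> \<phi> ` closure_space LA" if "y \<in> closure_space LB" for y
      using S.graph_closure_space[OF that, unfolded swap_iff] eq by blast
    moreover have "inj_on \<phi> (closure_space LA)"
    proof (rule inj_onI)
      fix x x' assume x: "x \<in> closure_space LA" "x' \<in> closure_space LA" "\<phi> x = \<phi> x'"
      show "x = x'" using inj[OF G[OF x(1)]] G[OF x(2)] x(3) by simp
    qed
    ultimately show "bij_betw \<phi> (closure_space LA) (closure_space LB)"
      using mem unfolding bij_betw_def by blast
    show "\<phi> (x + y) = \<phi> x + \<phi> y" if "x \<in> closure_space LA" "y \<in> closure_space LA" for x y
      using that by (intro eq graph_add G)
    show "\<phi> (r *\<^sub>R x) = r *\<^sub>R \<phi> x" if "x \<in> closure_space LA" for r x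
      using that by (intro eq graph_scaleR G)
    show "\<phi> x \<le> \<phi> y \<longleftrightarrow> x \<le> y" if "x \<in> closure_space LA" "y \<in> closure_space LA" for x y
      using graph_le[OF G[OF that(1)] G[OF that(2)]] S.graph_le[unfolded swap_iff, OF G[OF that(1)] G[OF that(2)]]
      by blast
    show "\<phi> order_unit = order_unit" by (rule eq[OF graph_order_unit])
    show "closure_norm LA x = closure_norm LB (\<phi> x)" if "x \<in> closure_space LA" for x
    proof -
      \<comment> \<open>The two gauges are infima over the same set of radii, since the graph
        matches balls of equal radius in both directions.\<close>
      have "x \<in> (*\<^sub>R) t ` closed_lip_ball LA \<longleftrightarrow> \<phi> x \<in> (*\<^sub>R) t ` closed_lip_ball LB" if "0 < t" for t
        using graph_ball[OF that G] S.graph_ball[unfolded swap_iff, OF that G] \<open>x \<in> closure_space LA\<close> by blast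
      then show ?thesis unfolding closure_norm_def by (simp cong: conj_cong)
    qed
  qed
  then show ?thesis by blast
qed

end

theorem theorem7p8:
  fixes LA :: "'a::order_unit_space \<Rightarrow> real"
    and LB :: "'b::order_unit_space \<Rightarrow> real"
  assumes "lip_norm LA" and "lip_norm LB"
    and "dist_q LA LB = 0"
  shows "\<exists>\<phi>. isometry LA LB \<phi>"
proof -
  \<comment> \<open>The infimum need not be attained, so each tolerance \<open>1 / (n + 1)\<close>
    gets its own bridge.\<close>
  have "\<exists>L. bridge (inverse (real (Suc n))) LA LB L" for n
    using assms(3) by (intro dist_q_less_imp_bridge) auto
  then obtain L where L: "\<And>n. bridge (inverse (real (Suc n))) LA LB (L n)" by metis
  obtain U :: "nat filter" where U: "U \<le> sequentially" "U \<noteq> bot"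
    "\<And>P. eventually P U \<or> eventually (\<lambda>n. \<not> P n) U"
    using ultrafilter_exists[of sequentially] by auto
  interpret bridge_sequence U LA LB L
    using U assms(1,2) L by unfold_locales
  show ?thesis by (rule isometry_exists)
qed

end
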